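(* Let $A$ be a unital $C^*$-algebra, $\Gamma$ a discrete group, and $\alpha:\Gamma\to \mathrm{Aut}(A)$ a group homomorphism. Equip all spaces of states with their weak-$*$ topologies. Then the restriction map $R: S^1(A\rtimes\Gamma)\to S_\Gamma(A)$, $R(\varphi)=\varphi|_A$, is a (well-defined) homeomorphism, and it restricts to a homeomorphism $R: P^1(A\rtimes\Gamma)\to E_\Gamma(A)$.
   Context: $A\rtimes\Gamma$ is the full crossed product $C^*$-algebra of $(A,\Gamma,\alpha)$: the universal $C^*$-completion of the $*$-algebra $C_c(\Gamma,A)$ of finite sums $\sum_{s} a_su_s$ ($a_s\in A$), where the $u_s$ ($s\in\Gamma$) are unitaries with $u_su_t=u_{st}$ and $u_sau_s^*=\alpha_s(a)$; $A$ is viewed as a unital $C^*$-subalgebra of $A\rtimes\Gamma$. $S(B)$ and $P(B)$ denote the state space and the pure state space of a unital $C^*$-algebra $B$. Put $S^1(A\rtimes\Gamma)=\{\varphi\in S(A\rtimes\Gamma): \varphi(u_s)=1 \text{ for all } s\in\Gamma\}$ and $P^1(A\rtimes\Gamma)=\{\psi\in P(A\rtimes\Gamma): \psi(u_s)=1 \text{ for all } s\in\Gamma\}$. A state $\varphi$ on $A$ is $\Gamma$-invariant if $\varphi(\alpha_s(a))=\varphi(a)$ for all $s\in\Gamma$, $a\in A$. $S_\Gamma(A)$ is the (weak-$*$ closed, convex) set of $\Gamma$-invariant states on $A$, and $E_\Gamma(A)$, the set of ergodic $\Gamma$-invariant states, is the set of extreme points of $S_\Gamma(A)$. *)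

theory Defs
  imports "HOL-Analysis.Analysis" "HOL-Algebra.Group"
begin

section \<open>Unital C*-algebras\<close>

text \<open>Nonzero unital C*-algebras: the class of real normed unital algebras already demands
  \<open>norm 1 = 1\<close>. The zero algebra has no states.\<close>

class unital_cstar_algebra = real_normed_algebra_1 + complete_space +
  fixes scaleC :: "complex \<Rightarrow> 'a \<Rightarrow> 'a"  (infixr \<open>*\<^sub>C\<close> 75)
    and star :: "'a \<Rightarrow> 'a"
  assumes scaleR_scaleC: "r *\<^sub>R x = complex_of_real r *\<^sub>C x"
    and scaleC_add_right: "c *\<^sub>C (x + y) = c *\<^sub>C x + c *\<^sub>C y"
    and scaleC_add_left: "(c + d) *\<^sub>C x = c *\<^sub>C x + d *\<^sub>C x"
    and scaleC_scaleC: "c *\<^sub>C (d *\<^sub>C x) = (c * d) *\<^sub>C x"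
    and scaleC_mult_left: "(c *\<^sub>C x) * y = c *\<^sub>C (x * y)"
    and scaleC_mult_right: "x * (c *\<^sub>C y) = c *\<^sub>C (x * y)"
    and norm_scaleC: "norm (c *\<^sub>C x) = cmod c * norm x"
    and star_star: "star (star x) = x"
    and star_add: "star (x + y) = star x + star y"
    and star_scaleC: "star (c *\<^sub>C x) = cnj c *\<^sub>C star x"
    and star_mult: "star (x * y) = star y * star x"
    and cstar_identity: "norm (star x * x) = (norm x)\<^sup>2"

definition unitary :: "'a::unital_cstar_algebra \<Rightarrow> bool" where
  "unitary v \<longleftrightarrow> star v * v = 1 \<and> v * star v = 1"

definition unital_star_hom ::
    "('a::unital_cstar_algebra \<Rightarrow> 'b::unital_cstar_algebra) \<Rightarrow> bool" where
  "unital_star_hom \<pi> \<longleftrightarrow>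
     Vector_Spaces.linear scaleC scaleC \<pi> \<and>
     (\<forall>x y. \<pi> (x * y) = \<pi> x * \<pi> y) \<and>
     (\<forall>x. \<pi> (star x) = star (\<pi> x)) \<and>
     \<pi> 1 = 1"

definition cstar_Aut :: "('a::unital_cstar_algebra \<Rightarrow> 'a) monoid" where
  "cstar_Aut = \<lparr>carrier = {f. unital_star_hom f \<and> bij f}, mult = (\<circ>), one = id\<rparr>"


section \<open>States and the weak-* topology\<close>

text \<open>Boundedness of a positive functional is automatic, and among positive functionals
  those of norm one are exactly the unital ones.\<close>

definition states :: "('a::unital_cstar_algebra \<Rightarrow> complex) set" where
  "states = {\<phi>. Vector_Spaces.linear scaleC (*) \<phi> \<and> bounded_linear \<phi> \<and>
                (\<forall>x. \<phi> (star x * x) \<in> \<real>\<^sub>\<ge>\<^sub>0) \<and> \<phi> 1 = 1}"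

text \<open>The library's \<open>extreme_point_of\<close> needs a real vector space type, and there is
  no such instance for the function type.\<close>

definition extreme_points :: "('a \<Rightarrow> complex) set \<Rightarrow> ('a \<Rightarrow> complex) set" where
  "extreme_points K = {\<phi> \<in> K. \<forall>\<psi>\<in>K. \<forall>\<rho>\<in>K. \<forall>t::real. 0 < t \<and> t < 1 \<and>
      \<phi> = (\<lambda>x. complex_of_real t * \<psi> x + complex_of_real (1 - t) * \<rho> x) \<longrightarrow> \<psi> = \<phi> \<and> \<rho> = \<phi>}"

definition pure_states :: "('a::unital_cstar_algebra \<Rightarrow> complex) set" where
  "pure_states = extreme_points states"

text \<open>The topology of pointwise convergence on a set of functionals.\<close>

definition weak_star :: "('a \<Rightarrow> complex) set \<Rightarrow> ('a \<Rightarrow> complex) topology" where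
  "weak_star K = subtopology (product_topology (\<lambda>_. euclidean) UNIV) K"


section \<open>The full crossed product\<close>

text \<open>The function \<open>f\<close> stands for the finite formal sum of the \<open>f s u\<^sub>s\<close>,
  \<open>s \<in> carrier G\<close>; it is extended by \<open>0\<close> off the carrier. Product and involution are
  those forced by \<open>u\<^sub>s a u\<^sub>s* = \<alpha>\<^sub>s(a)\<close>.\<close>

definition Cc :: "('g, 'm) monoid_scheme \<Rightarrow> ('g \<Rightarrow> 'a::unital_cstar_algebra) set" where
  "Cc G = {f. finite {s. f s \<noteq> 0} \<and> {s. f s \<noteq> 0} \<subseteq> carrier G}"

definition Cc_mult :: "('g, 'm) monoid_scheme \<Rightarrow> ('g \<Rightarrow> 'a \<Rightarrow> 'a) \<Rightarrow>
    ('g \<Rightarrow> 'a::unital_cstar_algebra) \<Rightarrow> ('g \<Rightarrow> 'a) \<Rightarrow> 'g \<Rightarrow> 'a" where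
  "Cc_mult G \<alpha> f g = (\<lambda>s. if s \<in> carrier G
     then \<Sum>t | f t \<noteq> 0. f t * \<alpha> t (g (inv\<^bsub>G\<^esub> t \<otimes>\<^bsub>G\<^esub> s)) else 0)"

definition Cc_star :: "('g, 'm) monoid_scheme \<Rightarrow> ('g \<Rightarrow> 'a \<Rightarrow> 'a) \<Rightarrow>
    ('g \<Rightarrow> 'a::unital_cstar_algebra) \<Rightarrow> 'g \<Rightarrow> 'a" where
  "Cc_star G \<alpha> f = (\<lambda>s. if s \<in> carrier G then \<alpha> s (star (f (inv\<^bsub>G\<^esub> s))) else 0)"

definition cstar_seminorm :: "('g, 'm) monoid_scheme \<Rightarrow> ('g \<Rightarrow> 'a \<Rightarrow> 'a) \<Rightarrow>
    (('g \<Rightarrow> 'a::unital_cstar_algebra) \<Rightarrow> real) \<Rightarrow> bool" where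
  "cstar_seminorm G \<alpha> p \<longleftrightarrow>
     (\<forall>f\<in>Cc G. 0 \<le> p f) \<and>
     (\<forall>f\<in>Cc G. \<forall>g\<in>Cc G. p (\<lambda>s. f s + g s) \<le> p f + p g) \<and>
     (\<forall>c. \<forall>f\<in>Cc G. p (\<lambda>s. c *\<^sub>C f s) = cmod c * p f) \<and>
     (\<forall>f\<in>Cc G. \<forall>g\<in>Cc G. p (Cc_mult G \<alpha> f g) \<le> p f * p g) \<and>
     (\<forall>f\<in>Cc G. p (Cc_mult G \<alpha> (Cc_star G \<alpha> f) f) = (p f)\<^sup>2)"

definition Cc_map :: "('a::unital_cstar_algebra \<Rightarrow> 'b::unital_cstar_algebra) \<Rightarrow>
    ('g \<Rightarrow> 'b) \<Rightarrow> ('g \<Rightarrow> 'a) \<Rightarrow> 'b" where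
  "Cc_map \<iota> u f = (\<Sum>s | f s \<noteq> 0. \<iota> (f s) * u s)"

text \<open>The type \<open>'b\<close>, with \<open>\<iota>\<close> and \<open>u\<close>, is (a model of, unique up to canonical isomorphism)
  the universal C*-completion of \<open>Cc G\<close>. The covariance relations make \<open>Cc_map \<iota> u\<close>
  a *-homomorphism, so that \<open>norm \<circ> Cc_map \<iota> u\<close> is itself a C*-seminorm; the last
  clause says that it is the greatest one. Injectivity of \<open>\<iota>\<close> is a consequence.\<close>

definition full_crossed_product :: "('g, 'm) monoid_scheme \<Rightarrow> ('g \<Rightarrow> 'a \<Rightarrow> 'a) \<Rightarrow>
    ('a::unital_cstar_algebra \<Rightarrow> 'b::unital_cstar_algebra) \<Rightarrow> ('g \<Rightarrow> 'b) \<Rightarrow> bool" where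
  "full_crossed_product G \<alpha> \<iota> u \<longleftrightarrow>
     unital_star_hom \<iota> \<and>
     (\<forall>s\<in>carrier G. unitary (u s)) \<and>
     (\<forall>s\<in>carrier G. \<forall>t\<in>carrier G. u s * u t = u (s \<otimes>\<^bsub>G\<^esub> t)) \<and>
     (\<forall>s\<in>carrier G. \<forall>a. u s * \<iota> a * star (u s) = \<iota> (\<alpha> s a)) \<and>
     closure (Cc_map \<iota> u ` Cc G) = UNIV \<and>
     (\<forall>p. cstar_seminorm G \<alpha> p \<longrightarrow> (\<forall>f\<in>Cc G. p f \<le> norm (Cc_map \<iota> u f)))"


section \<open>The state spaces\<close>

definition S1 :: "('g, 'm) monoid_scheme \<Rightarrow> ('g \<Rightarrow> 'b::unital_cstar_algebra) \<Rightarrow>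
    ('b \<Rightarrow> complex) set" where
  "S1 G u = {\<phi> \<in> states. \<forall>s\<in>carrier G. \<phi> (u s) = 1}"

definition P1 :: "('g, 'm) monoid_scheme \<Rightarrow> ('g \<Rightarrow> 'b::unital_cstar_algebra) \<Rightarrow>
    ('b \<Rightarrow> complex) set" where
  "P1 G u = {\<psi> \<in> pure_states. \<forall>s\<in>carrier G. \<psi> (u s) = 1}"

definition invariant_states :: "('g, 'm) monoid_scheme \<Rightarrow>
    ('g \<Rightarrow> 'a \<Rightarrow> 'a::unital_cstar_algebra) \<Rightarrow> ('a \<Rightarrow> complex) set" where
  "invariant_states G \<alpha> = {\<phi> \<in> states. \<forall>s\<in>carrier G. \<forall>a. \<phi> (\<alpha> s a) = \<phi> a}"

definition ergodic_states :: "('g, 'm) monoid_scheme \<Rightarrow>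
    ('g \<Rightarrow> 'a \<Rightarrow> 'a::unital_cstar_algebra) \<Rightarrow> ('a \<Rightarrow> complex) set" where
  "ergodic_states G \<alpha> = extreme_points (invariant_states G \<alpha>)"

definition restriction :: "('a \<Rightarrow> 'b) \<Rightarrow> ('b \<Rightarrow> complex) \<Rightarrow> 'a \<Rightarrow> complex" where
  "restriction \<iota> \<phi> = \<phi> \<circ> \<iota>"

end

theory Submission
  imports Defs
begin

text \<open>
  A state that takes the value \<open>1\<close> at every \<open>u s\<close> is unchanged by multiplication with \<open>u s\<close>
  on either side, so it is determined by its restriction to \<open>A\<close>, and this restriction is
  invariant. Conversely, an invariant state \<open>\<phi>\<close> gives a covariant representation on the GNS
  space of \<open>\<phi>\<close>, in which \<open>u s\<close> fixes the cyclic vector; the vector functional of the cyclic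
  vector is bounded by the operator seminorm, hence by the universal norm, and extends to the
  crossed product. States are contractive, so the inverse of the restriction map is a
  pointwise uniform limit of evaluations. The second homeomorphism follows because the
  restriction is affine and \<open>S1 G u\<close> is a face of the state space.
\<close>

section \<open>Square roots in unital C*-algebras\<close>

instance unital_cstar_algebra \<subseteq> banach ..

section \<open>Elementary rules for scalars and the involution\<close>

lemma scaleC_one [simp]: "1 *\<^sub>C x = x"
  using scaleR_scaleC[of 1 x] by simp

lemma vector_space_scaleC: "vector_space (scaleC :: complex \<Rightarrow> 'a::unital_cstar_algebra \<Rightarrow> 'a)"
  by unfold_locales (simp_all add: scaleC_add_right scaleC_add_left scaleC_scaleC)

lemma linear_functional_iff:
  "Vector_Spaces.linear (scaleC :: complex \<Rightarrow> 'a::unital_cstar_algebra \<Rightarrow> 'a) (*) \<phi> \<longleftrightarrow>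
     (\<forall>x y. \<phi> (x + y) = \<phi> x + \<phi> y) \<and> (\<forall>c x. \<phi> (c *\<^sub>C x) = c * \<phi> x)"
proof -
  have "vector_space ((*) :: complex \<Rightarrow> complex \<Rightarrow> complex)"
    by unfold_locales (simp_all add: algebra_simps)
  then show ?thesis
    using vector_space_scaleC by (auto simp: Vector_Spaces.linear_iff)
qed

lemma star_one [simp]: "star (1 :: 'a::unital_cstar_algebra) = 1"
  by (metis mult.right_neutral mult.left_neutral star_mult star_star)

lemma star_zero [simp]: "star (0 :: 'a::unital_cstar_algebra) = 0"
  by (metis add_cancel_right_right star_add)

lemma star_minus: "star (- x :: 'a::unital_cstar_algebra) = - star x"
  by (metis add.right_inverse add_eq_0_iff star_add star_zero)

lemma star_diff: "star (x - y :: 'a::unital_cstar_algebra) = star x - star y"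
  by (metis diff_conv_add_uminus star_add star_minus)

lemma star_power: "star (x ^ n :: 'a::unital_cstar_algebra) = star x ^ n"
  by (induction n) (simp_all add: star_mult power_commutes)

lemma star_sum: "star (\<Sum>i\<in>I. f i :: 'a::unital_cstar_algebra) = (\<Sum>i\<in>I. star (f i))"
  by (induction I rule: infinite_finite_induct) (simp_all add: star_add)

lemma star_scaleR: "star (r *\<^sub>R x :: 'a::unital_cstar_algebra) = r *\<^sub>R star x"
  by (simp add: scaleR_scaleC star_scaleC)

lemma norm_star [simp]: "norm (star x :: 'a::unital_cstar_algebra) = norm x"
proof -
  have le: "norm y \<le> norm (star y)" for y :: 'a
  proof (cases "y = 0")
    case False
    have "norm y * norm y \<le> norm (star y) * norm y"
      using norm_mult_ineq[of "star y" y] by (simp add: cstar_identity power2_eq_square)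
    then show ?thesis using False by simp
  qed simp
  show ?thesis using le[of x] le[of "star x"] by (simp add: star_star)
qed

lemma bounded_linear_star: "bounded_linear (star :: 'a::unital_cstar_algebra \<Rightarrow> 'a)"
  by (intro bounded_linear_intro[where K = 1]) (simp_all add: star_add star_scaleR)

lemma bounded_linear_scaleC: "bounded_linear (\<lambda>x :: 'a::unital_cstar_algebra. c *\<^sub>C x)"
  by (intro bounded_linear_intro[where K = "cmod c"])
    (simp_all add: scaleC_add_right scaleR_scaleC scaleC_scaleC norm_scaleC mult.commute)

text \<open>The binomial series for the square root of \<open>1 + x\<close> is evaluated at
  \<open>- h\<close>; its real coefficients make the sum selfadjoint. This is the source of the
  positive elements behind the norm bounds for positive functionals.\<close>

lemma selfadjoint_sqrt_one_minus:
  fixes h :: "'a::unital_cstar_algebra"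
  assumes h: "star h = h" and "norm h < 1"
  obtains y where "star y = y" and "y * y = 1 - h"
proof -
  define c where "c n = ((1/2::real) gchoose n)" for n
  define a where "a n = c n *\<^sub>R (- h) ^ n" for n
  define y where "y = (\<Sum>n. a n)"
  \<comment> \<open>The scalar series converges at \<open>r\<close>, hence absolutely at the smaller
    radius \<open>norm h\<close>, where it dominates the series of \<open>a\<close>.\<close>
  obtain r where r: "norm h < r" "r < 1" using \<open>norm h < 1\<close> dense by blast
  have "summable (\<lambda>n. c n * r ^ n)"
    unfolding c_def using r norm_ge_zero[of h]
    by (intro sums_summable[OF gen_binomial_real]) linarith
  then have "summable (\<lambda>n. norm (c n * norm h ^ n))"
    by (rule powser_insidea) (use r norm_ge_zero[of h] in simp)
  then have a: "summable (\<lambda>n. norm (a n))"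
    by (rule summable_comparison_test[rotated])
      (auto simp: a_def abs_mult norm_power_ineq[of "- h", simplified] intro!: mult_left_mono)
  have "star y = (\<Sum>n. star (a n))"
    unfolding y_def by (rule bounded_linear.suminf[OF bounded_linear_star summable_norm_cancel[OF a]])
  also have "\<dots> = y"
    by (simp add: y_def a_def star_scaleR star_power star_minus h)
  finally have sy: "star y = y" .
  \<comment> \<open>The Vandermonde convolution turns the coefficients of exponent 1/2 into those of
    exponent 1, which vanish beyond degree 1.\<close>
  have "(\<Sum>i\<le>k. a i * a (k - i)) = (1 gchoose k) *\<^sub>R (- h) ^ k" for k
  proof -
    have "(\<Sum>i\<le>k. a i * a (k - i)) = (\<Sum>i\<le>k. (c i * c (k - i)) *\<^sub>R (- h) ^ k)"
      by (intro sum.cong) (auto simp: a_def simp flip: power_add)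
    also have "\<dots> = (1 gchoose k) *\<^sub>R (- h) ^ k"
      using gbinomial_Vandermonde[of "1/2::real" "1/2" k]
      by (simp add: c_def atLeast0AtMost flip: scaleR_sum_left)
    finally show ?thesis .
  qed
  then have "(\<lambda>k. (1 gchoose k) *\<^sub>R (- h) ^ k) sums (y * y)"
    using Cauchy_product_sums[OF a a] by (simp add: y_def)
  moreover have "(\<lambda>k. (1 gchoose k) *\<^sub>R (- h) ^ k) sums (\<Sum>k\<in>{0,1}. (1 gchoose k) *\<^sub>R (- h) ^ k)"
  proof (rule sums_finite)
    fix k :: nat assume "k \<notin> {0,1}"
    then have "(1::real) gchoose k = 0"
      using binomial_gbinomial[of 1 k, where ?'a = real] by (simp add: binomial_eq_0)
    then show "(1 gchoose k) *\<^sub>R (- h) ^ k = 0" by simp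
  qed simp
  ultimately have "y * y = 1 - h" by (simp add: sums_iff)
  with sy show ?thesis by (rule that)
qed


section \<open>Positive functionals\<close>

locale positive_functional =
  fixes \<phi> :: "'a::unital_cstar_algebra \<Rightarrow> complex"
  assumes add: "\<phi> (x + y) = \<phi> x + \<phi> y"
    and scaleC: "\<phi> (c *\<^sub>C x) = c * \<phi> x"
    and nonneg: "\<phi> (star x * x) \<in> \<real>\<^sub>\<ge>\<^sub>0"
begin

lemma zero [simp]: "\<phi> 0 = 0"
  using add[of 0 0] by simp

lemma minus: "\<phi> (- x) = - \<phi> x"
  using add[of x "- x"] by (simp add: add_eq_0_iff)

lemma diff: "\<phi> (x - y) = \<phi> x - \<phi> y"
  using add[of x "- y"] minus by simp

lemma sum: "\<phi> (\<Sum>i\<in>I. f i) = (\<Sum>i\<in>I. \<phi> (f i))"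
  by (induction I rule: infinite_finite_induct) (simp_all add: add)

lemma scaleR: "\<phi> (r *\<^sub>R x) = r *\<^sub>R \<phi> x"
  by (simp add: scaleR_scaleC scaleC scaleR_conv_of_real)

section \<open>The GNS seminorm and the Cauchy-Schwarz inequality\<close>

definition nrm :: "'a \<Rightarrow> real" where
  "nrm x = sqrt (Re (\<phi> (star x * x)))"

lemma nrm_nonneg [simp]: "0 \<le> nrm x"
  using nonneg[of x] by (simp add: nrm_def complex_nonneg_Reals_iff)

lemma nrm_sq: "complex_of_real ((nrm x)\<^sup>2) = \<phi> (star x * x)"
  using nonneg[of x] by (simp add: nrm_def complex_nonneg_Reals_iff complex_eq_iff)

lemma nrm_sq': "(nrm x)\<^sup>2 = Re (\<phi> (star x * x))"
  using nonneg[of x] by (simp add: nrm_def complex_nonneg_Reals_iff)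

text \<open>Polarization: positivity at \<open>x + c *\<^sub>C y\<close> makes the sum of the two
  cross terms real; \<open>c = 1\<close> compares imaginary parts and \<open>c = \<i>\<close>
  compares real parts.\<close>

lemma hermitian: "\<phi> (star x * y) = cnj (\<phi> (star y * x))"
proof -
  have im: "Im (c * \<phi> (star x * y) + cnj c * \<phi> (star y * x)) = 0" for c
  proof -
    have "\<phi> (star (x + c *\<^sub>C y) * (x + c *\<^sub>C y)) =
      \<phi> (star x * x) + c * \<phi> (star x * y) + cnj c * \<phi> (star y * x)
        + cnj c * c * \<phi> (star y * y)"
      by (simp add: star_add star_scaleC algebra_simps scaleC_mult_left scaleC_mult_right
          scaleC_scaleC add scaleC)
    then show ?thesis
      using nonneg[of "x + c *\<^sub>C y"] nonneg[of x] nonneg[of y]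
      by (simp add: complex_nonneg_Reals_iff)
  qed
  show ?thesis
    using im[of 1] im[of \<i>] by (simp add: complex_eq_iff)
qed

lemma cauchy_schwarz: "cmod (\<phi> (star x * y)) \<le> nrm x * nrm y"
proof -
  define z where "z = \<phi> (star x * y)"
  define A where "A = (nrm x)\<^sup>2"
  define B where "B = (nrm y)\<^sup>2"
  have B: "B \<ge> 0" and A: "A \<ge> 0" by (simp_all add: A_def B_def)
  have quad: "0 \<le> A - 2 * t * (cmod z)\<^sup>2 + t\<^sup>2 * (cmod z)\<^sup>2 * B" for t
  proof -
    \<comment> \<open>With the factor \<open>cnj z\<close> both cross terms become
      \<open>- t * (cmod z)\<^sup>2\<close>, so the expansion is a real quadratic polynomial in
      \<open>t\<close>.\<close>
    define c where "c = - of_real t * cnj z"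
    have "\<phi> (star (x + c *\<^sub>C y) * (x + c *\<^sub>C y)) =
      \<phi> (star x * x) + c * \<phi> (star x * y) + cnj c * \<phi> (star y * x)
        + cnj c * c * \<phi> (star y * y)"
      by (simp add: star_add star_scaleC algebra_simps scaleC_mult_left scaleC_mult_right
          scaleC_scaleC add scaleC)
    also have "\<dots> = of_real A - 2 * of_real t * (z * cnj z) + of_real (t\<^sup>2 * B) * (z * cnj z)"
      by (simp add: A_def B_def nrm_sq[symmetric] c_def hermitian[of y x] flip: z_def)
        (simp add: power2_eq_square)
    also have "\<dots> = of_real (A - 2 * t * (cmod z)\<^sup>2 + t\<^sup>2 * (cmod z)\<^sup>2 * B)"
      by (simp add: complex_norm_square[symmetric])
    finally show ?thesis
      using nonneg[of "x + c *\<^sub>C y"] by (simp add: complex_nonneg_Reals_iff del: of_real_add of_real_diff)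
  qed
  have "(cmod z)\<^sup>2 \<le> A * B"
  proof (cases "B = 0")
    case True
    show ?thesis
    proof (rule ccontr)
      assume "\<not> ?thesis"
      then have "(cmod z)\<^sup>2 > 0" using True by simp
      \<comment> \<open>For \<open>B = 0\<close> the polynomial is linear, and at this
        \<open>t\<close> it takes the value \<open>-1\<close>.\<close>
      then show False
        using quad[of "(A + 1) / (2 * (cmod z)\<^sup>2)"] True by (simp add: field_simps)
    qed
  next
    case False
    then have "B > 0" using B by simp
    \<comment> \<open>The quadratic is minimal at \<open>1 / B\<close>.\<close>
    then show ?thesis using quad[of "1 / B"] by (simp add: field_simps power2_eq_square)
  qed
  then have "(cmod z)\<^sup>2 \<le> (nrm x * nrm y)\<^sup>2"
    by (simp add: A_def B_def power_mult_distrib)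
  then show ?thesis unfolding z_def by (rule power2_le_imp_le) simp
qed

lemma nrm_add: "nrm (x + y) \<le> nrm x + nrm y"
proof (rule power2_le_imp_le)
  have "(nrm (x + y))\<^sup>2 = (nrm x)\<^sup>2 + (nrm y)\<^sup>2 + 2 * Re (\<phi> (star x * y))"
    using hermitian[of x y] by (simp add: nrm_sq' star_add algebra_simps add)
  also have "\<dots> \<le> (nrm x)\<^sup>2 + (nrm y)\<^sup>2 + 2 * (nrm x * nrm y)"
    using cauchy_schwarz[of x y] complex_Re_le_cmod[of "\<phi> (star x * y)"] by linarith
  finally show "(nrm (x + y))\<^sup>2 \<le> (nrm x + nrm y)\<^sup>2"
    by (simp add: power2_sum)
qed simp

lemma nrm_scaleC: "nrm (c *\<^sub>C x) = cmod c * nrm x"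
proof -
  have "complex_of_real ((nrm (c *\<^sub>C x))\<^sup>2) = (c * cnj c) * of_real ((nrm x)\<^sup>2)"
    unfolding nrm_sq
    by (simp add: star_scaleC scaleC_mult_left scaleC_mult_right scaleC_scaleC scaleC)
  also have "\<dots> = of_real ((cmod c * nrm x)\<^sup>2)"
    by (simp add: power_mult_distrib flip: complex_norm_square)
  finally have "(nrm (c *\<^sub>C x))\<^sup>2 = (cmod c * nrm x)\<^sup>2"
    unfolding of_real_eq_iff .
  then show ?thesis by simp
qed

lemma nrm_zero [simp]: "nrm 0 = 0"
  by (simp add: nrm_def)

lemma nrm_sum: "nrm (\<Sum>i\<in>I. f i) \<le> (\<Sum>i\<in>I. nrm (f i))"
  by (induction I rule: infinite_finite_induct) (auto intro: order.trans[OF nrm_add])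

text \<open>For every \<open>r > norm h\<close> the element \<open>1 - (1 / r) *\<^sub>R h\<close>
  is the square of a selfadjoint element, so \<open>\<phi>\<close> has nonnegative real part there;
  then \<open>r\<close> decreases to \<open>norm h\<close>.\<close>

lemma selfadjoint_bound:
  assumes h: "star h = h"
  shows "Re (\<phi> h) \<le> norm h * Re (\<phi> 1)"
proof -
  have "Re (\<phi> h) \<le> r * Re (\<phi> 1)" if hr: "r > norm h" for r
  proof -
    have r: "r > 0" using hr norm_ge_zero[of h] by linarith
    obtain y where "star y = y" "y * y = 1 - (1 / r) *\<^sub>R h"
      by (rule selfadjoint_sqrt_one_minus[of "(1 / r) *\<^sub>R h"])
        (use hr r h in \<open>auto simp: star_scaleR field_simps\<close>)
    then have "Re (\<phi> (1 - (1 / r) *\<^sub>R h)) \<ge> 0"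
      using nonneg[of y] by (simp add: complex_nonneg_Reals_iff)
    then show ?thesis using r by (simp add: diff scaleR field_simps)
  qed
  moreover have "((\<lambda>r. r * Re (\<phi> 1)) \<longlongrightarrow> norm h * Re (\<phi> 1)) (at_right (norm h))"
    by (intro tendsto_intros)
  ultimately show ?thesis
    by (intro tendsto_lowerbound[of _ _ "at_right (norm h)"])
      (auto simp: eventually_at_filter)
qed

text \<open>The functional \<open>y \<mapsto> \<phi> (star b * y * b)\<close> is again positive, so
  the selfadjoint bound applies to it at \<open>star a * a\<close>, and the C*-identity evaluates
  the norm. Left multiplications are thus bounded for the GNS seminorm.\<close>

lemma nrm_mult: "nrm (a * b) \<le> norm a * nrm b"
proof (rule power2_le_imp_le)
  interpret conj: positive_functional "\<lambda>y. \<phi> (star b * y * b)"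
  proof
    fix x show "\<phi> (star b * (star x * x) * b) \<in> \<real>\<^sub>\<ge>\<^sub>0"
      using nonneg[of "x * b"] by (simp add: star_mult mult.assoc)
  qed (simp_all add: algebra_simps add scaleC_mult_left scaleC_mult_right scaleC)
  have "(nrm (a * b))\<^sup>2 = Re (\<phi> (star b * (star a * a) * b))"
    by (simp add: nrm_sq' star_mult mult.assoc)
  also have "\<dots> \<le> norm (star a * a) * Re (\<phi> (star b * 1 * b))"
    by (rule conj.selfadjoint_bound) (simp add: star_mult star_star)
  also have "\<dots> = (norm a * nrm b)\<^sup>2"
    by (simp add: cstar_identity nrm_sq' power_mult_distrib)
  finally show "(nrm (a * b))\<^sup>2 \<le> (norm a * nrm b)\<^sup>2" .
qed simp

lemma norm_bound: "cmod (\<phi> x) \<le> (nrm 1)\<^sup>2 * norm x"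
proof -
  have "cmod (\<phi> x) \<le> nrm 1 * nrm x"
    using cauchy_schwarz[of 1 x] by simp
  also have "\<dots> \<le> nrm 1 * (norm x * nrm 1)"
    using nrm_mult[of x 1] by (intro mult_left_mono) auto
  finally show ?thesis by (simp add: power2_eq_square mult_ac)
qed

lemma bounded_linear: "bounded_linear \<phi>"
  by (rule bounded_linear_intro[where K = "(nrm 1)\<^sup>2"])
    (simp_all add: add scaleR norm_bound mult.commute[of "norm _"])

end

lemma states_iff: "\<phi> \<in> states \<longleftrightarrow> positive_functional \<phi> \<and> \<phi> 1 = 1"
  using positive_functional.bounded_linear[of \<phi>]
  by (auto simp: states_def linear_functional_iff positive_functional_def)

section \<open>States and their multiplicative domain\<close>

locale state = positive_functional +
  assumes unital [simp]: "\<phi> 1 = 1"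
begin

lemma nrm_one [simp]: "nrm 1 = 1"
  by (simp add: nrm_def)

lemma contractive: "cmod (\<phi> x) \<le> norm x"
  using norm_bound[of x] by simp

lemma cnj_star: "\<phi> (star x) = cnj (\<phi> x)"
  using hermitian[of x 1] by simp

text \<open>A unitary \<open>v\<close> with \<open>\<phi> v = 1\<close> lies in the multiplicative domain of \<open>\<phi>\<close>, since
  \<open>v - 1\<close> is then a null vector of the seminorm \<open>nrm\<close>.\<close>

lemma mult_unitary_right:
  assumes "unitary v" and v: "\<phi> v = 1"
  shows "\<phi> (x * v) = \<phi> x"
proof -
  have "star (v - 1) * (v - 1) = 1 + 1 - v - star v"
    using assms(1) by (simp add: unitary_def star_diff algebra_simps)
  then have "nrm (v - 1) = 0"
    by (simp add: nrm_def diff add v cnj_star del: one_add_one)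
  then have "\<phi> (star (star x) * (v - 1)) = 0"
    using cauchy_schwarz[of "star x" "v - 1"] by simp
  then show ?thesis by (simp add: star_star algebra_simps diff)
qed

text \<open>The adjoint of \<open>v\<close> is a unitary with the same value \<open>1\<close>, so
  taking adjoints reduces the claim to right multiplication.\<close>

lemma mult_unitary_left:
  assumes "unitary v" and v: "\<phi> v = 1"
  shows "\<phi> (v * x) = \<phi> x"
proof -
  have "\<phi> (star x * star v) = \<phi> (star x)"
    by (rule mult_unitary_right) (use assms in \<open>auto simp: unitary_def star_star cnj_star\<close>)
  then show ?thesis by (simp add: cnj_star flip: star_mult)
qed

end

lemma states_iff_state: "\<phi> \<in> states \<longleftrightarrow> state \<phi>"
  by (simp add: states_iff state_def state_axioms_def)


section \<open>Finitely supported functions\<close>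

lemma unital_star_homD:
  assumes "unital_star_hom \<pi>"
  shows "\<pi> (x + y) = \<pi> x + \<pi> y" "\<pi> (c *\<^sub>C x) = c *\<^sub>C \<pi> x" "\<pi> (x * y) = \<pi> x * \<pi> y"
    "\<pi> (star x) = star (\<pi> x)" "\<pi> 1 = 1" "\<pi> 0 = 0"
proof -
  show add: "\<pi> (x + y) = \<pi> x + \<pi> y" for x y
    using assms by (simp add: unital_star_hom_def Vector_Spaces.linear_iff)
  show "\<pi> 0 = 0" using add[of 0 0] by simp
qed (use assms in \<open>simp_all add: unital_star_hom_def Vector_Spaces.linear_iff\<close>)

text \<open>A common scheme for \<open>Cc_map\<close>, for the GNS action and for the linear
  extension of a functional, so that changes of summation index are carried out only once.\<close>

definition Cc_sum :: "('g \<Rightarrow> 'a \<Rightarrow> 'c) \<Rightarrow> ('g \<Rightarrow> 'a::zero) \<Rightarrow> 'c::comm_monoid_add" where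
  "Cc_sum h f = (\<Sum>s | f s \<noteq> 0. h s (f s))"

lemma Cc_sum_superset:
  assumes "finite S" "\<And>s. f s \<noteq> 0 \<Longrightarrow> s \<in> S" and h: "\<And>s. h s 0 = 0"
  shows "Cc_sum h f = (\<Sum>s\<in>S. h s (f s))"
  unfolding Cc_sum_def by (rule sum.mono_neutral_left) (use assms in auto)

lemma Cc_sum_single:
  assumes "h s 0 = 0"
  shows "Cc_sum h (\<lambda>t. if t = s then a else 0) = h s a"
proof -
  have "{t. (if t = s then a else 0) \<noteq> 0} = (if a = 0 then {} else {s})" by auto
  then show ?thesis using assms by (simp add: Cc_sum_def)
qed

lemma Cc_single: "s \<in> carrier G \<Longrightarrow> (\<lambda>t. if t = s then a else 0) \<in> Cc G"
  by (auto simp: Cc_def intro: finite_subset[of _ "{s}"])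

lemma Cc_add: "f \<in> Cc G \<Longrightarrow> g \<in> Cc G \<Longrightarrow> (\<lambda>s. f s + g s) \<in> Cc G"
  by (auto simp: Cc_def intro: finite_subset[of _ "{s. f s \<noteq> 0} \<union> {s. g s \<noteq> 0}"])
    (metis (mono_tags, lifting) add.right_neutral mem_Collect_eq subsetD)

lemma scaleC_zero [simp]: "c *\<^sub>C 0 = (0 :: 'a::unital_cstar_algebra)"
  using scaleC_add_right[of c "0::'a" 0] by simp

lemma Cc_scale: "f \<in> Cc G \<Longrightarrow> (\<lambda>s. c *\<^sub>C f s) \<in> Cc G"
  by (auto simp: Cc_def intro: finite_subset[of _ "{s. f s \<noteq> 0}"])

lemma Cc_sum_add:
  assumes "f \<in> Cc G" "g \<in> Cc G"
    and h: "\<And>s a b. h s (a + b) = h s a + h s b" "\<And>s. h s 0 = 0"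
  shows "Cc_sum h (\<lambda>s. f s + g s) = Cc_sum h f + Cc_sum h g"
proof -
  define S where "S = {s. f s \<noteq> 0} \<union> {s. g s \<noteq> 0}"
  have S: "finite S" using assms by (simp add: S_def Cc_def)
  have "Cc_sum h (\<lambda>s. f s + g s) = (\<Sum>s\<in>S. h s (f s + g s))"
    by (rule Cc_sum_superset) (use S h in \<open>auto simp: S_def\<close>)
  also have "\<dots> = (\<Sum>s\<in>S. h s (f s)) + (\<Sum>s\<in>S. h s (g s))"
    by (simp add: h sum.distrib)
  also have "\<dots> = Cc_sum h f + Cc_sum h g"
    by (intro arg_cong2[of _ _ _ _ "(+)"] Cc_sum_superset[symmetric])
      (use S h in \<open>auto simp: S_def\<close>)
  finally show ?thesis .
qed

text \<open>Here \<open>k\<close> abstracts scalar multiplication on the target, which is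
  \<open>scaleC\<close> for an algebra and ordinary multiplication for the complex numbers.\<close>

lemma Cc_sum_scale:
  assumes "f \<in> Cc G"
    and h: "\<And>s a. h s (c *\<^sub>C a) = k (h s a)" "\<And>s. h s 0 = 0"
    and k: "\<And>x y. k (x + y) = k x + k y" "k 0 = 0"
  shows "Cc_sum h (\<lambda>s. c *\<^sub>C f s) = k (Cc_sum h f)"
proof -
  define S where "S = {s. f s \<noteq> 0}"
  have S: "finite S" using assms by (simp add: S_def Cc_def)
  have "Cc_sum h (\<lambda>s. c *\<^sub>C f s) = (\<Sum>s\<in>S. h s (c *\<^sub>C f s))"
    by (rule Cc_sum_superset) (use S h in \<open>auto simp: S_def\<close>)
  also have "\<dots> = k (\<Sum>s\<in>S. h s (f s))"
    using S by induction (simp_all add: h k)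
  finally show ?thesis by (simp add: Cc_sum_def S_def)
qed

section \<open>The convolution algebra of a dynamical system\<close>

locale cstar_dynamical_system = group G for G :: "('g, 'm) monoid_scheme" (structure) +
  fixes \<alpha> :: "'g \<Rightarrow> 'a::unital_cstar_algebra \<Rightarrow> 'a"
  assumes action: "\<alpha> \<in> hom G cstar_Aut"
begin

lemma action_hom: "s \<in> carrier G \<Longrightarrow> unital_star_hom (\<alpha> s)"
  and action_bij: "s \<in> carrier G \<Longrightarrow> bij (\<alpha> s)"
  and action_mult: "s \<in> carrier G \<Longrightarrow> t \<in> carrier G \<Longrightarrow> \<alpha> (s \<otimes> t) x = \<alpha> s (\<alpha> t x)"
  using action by (auto simp: hom_def cstar_Aut_def)

lemmas action_simps = unital_star_homD[OF action_hom]

text \<open>An injective idempotent map is the identity.\<close>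

lemma action_one: "\<alpha> \<one> x = x"
  using action_mult[of \<one> \<one> x] action_bij[of \<one>] by (auto simp: bij_def inj_def)

lemma action_inv: "s \<in> carrier G \<Longrightarrow> \<alpha> (inv\<^bsub>G\<^esub> s) (\<alpha> s x) = x"
  using action_mult[of "inv\<^bsub>G\<^esub> s" s x] by (simp add: action_one)

lemma Cc_mult_support:
  assumes f: "f \<in> Cc G" and g: "g \<in> Cc G" and s: "Cc_mult G \<alpha> f g s \<noteq> 0"
  shows "s \<in> (\<lambda>(t, r). t \<otimes> r) ` ({t. f t \<noteq> 0} \<times> {r. g r \<noteq> 0})"
proof -
  from s have sG: "s \<in> carrier G" by (auto simp: Cc_mult_def split: if_splits)
  with s have "(\<Sum>t | f t \<noteq> 0. f t * \<alpha> t (g (inv\<^bsub>G\<^esub> t \<otimes> s))) \<noteq> 0"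
    by (simp add: Cc_mult_def)
  then obtain t where t: "f t \<noteq> 0" "f t * \<alpha> t (g (inv\<^bsub>G\<^esub> t \<otimes> s)) \<noteq> 0"
    by (auto elim: sum.not_neutral_contains_not_neutral)
  have tG: "t \<in> carrier G" using t f by (auto simp: Cc_def)
  have "g (inv\<^bsub>G\<^esub> t \<otimes> s) \<noteq> 0"
    using t(2) action_simps(6)[OF tG] by auto
  moreover have "s = t \<otimes> (inv\<^bsub>G\<^esub> t \<otimes> s)"
    using tG sG by (simp add: m_assoc[symmetric])
  ultimately show ?thesis using t by (auto intro!: image_eqI[of _ _ "(t, inv\<^bsub>G\<^esub> t \<otimes> s)"])
qed

lemma Cc_mult_closed:
  assumes f: "f \<in> Cc G" and g: "g \<in> Cc G"
  shows "Cc_mult G \<alpha> f g \<in> Cc G"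
proof -
  have "finite {s. Cc_mult G \<alpha> f g s \<noteq> 0}"
    by (rule finite_subset[OF subsetI[OF Cc_mult_support[OF f g]]]) (use f g in \<open>auto simp: Cc_def\<close>)
  then show ?thesis by (auto simp: Cc_def Cc_mult_def split: if_splits)
qed

text \<open>Substituting \<open>s = t \<otimes> r\<close> splits a sum over the convolution into a
  double sum over the two supports. Multiplicativity of both \<open>Cc_map\<close> and
  \<open>act\<close> rests on this.\<close>

lemma Cc_sum_mult:
  assumes f: "f \<in> Cc G" and g: "g \<in> Cc G"
    and h: "\<And>s a b. h s (a + b) = h s a + h s b" "\<And>s. h s 0 = 0"
  shows "Cc_sum h (Cc_mult G \<alpha> f g) =
    (\<Sum>t | f t \<noteq> 0. \<Sum>r | g r \<noteq> 0. h (t \<otimes> r) (f t * \<alpha> t (g r)))"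
proof -
  define K where "K = (\<lambda>(t, r). t \<otimes> r) ` ({t. f t \<noteq> 0} \<times> {r. g r \<noteq> 0})"
  have fin: "finite {t. f t \<noteq> 0}" "finite {r. g r \<noteq> 0}" "finite K"
    using f g by (auto simp: Cc_def K_def)
  have fG: "t \<in> carrier G" if "f t \<noteq> 0" for t using f that by (auto simp: Cc_def)
  have gG: "r \<in> carrier G" if "g r \<noteq> 0" for r using g that by (auto simp: Cc_def)
  have KG: "s \<in> carrier G" if "s \<in> K" for s using that fG gG by (auto simp: K_def)
  have h_sum: "h s (\<Sum>i\<in>I. x i) = (\<Sum>i\<in>I. h s (x i))" if "finite I" for s and I :: "'g set" and x
    using that by induction (simp_all add: h)
  have "Cc_sum h (Cc_mult G \<alpha> f g) = (\<Sum>s\<in>K. h s (Cc_mult G \<alpha> f g s))"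
    by (rule Cc_sum_superset) (use fin Cc_mult_support[OF f g] h in \<open>auto simp: K_def\<close>)
  also have "\<dots> = (\<Sum>s\<in>K. \<Sum>t | f t \<noteq> 0. h s (f t * \<alpha> t (g (inv\<^bsub>G\<^esub> t \<otimes> s))))"
    by (intro sum.cong) (simp_all add: Cc_mult_def KG h_sum fin)
  also have "\<dots> = (\<Sum>t | f t \<noteq> 0. \<Sum>s\<in>K. h s (f t * \<alpha> t (g (inv\<^bsub>G\<^esub> t \<otimes> s))))"
    by (rule sum.swap)
  also have "\<dots> = (\<Sum>t | f t \<noteq> 0. \<Sum>r | g r \<noteq> 0. h (t \<otimes> r) (f t * \<alpha> t (g r)))"
  proof (rule sum.cong[OF refl])
    fix t assume "t \<in> {t. f t \<noteq> 0}"
    then have t: "f t \<noteq> 0" and tG: "t \<in> carrier G" using fG by auto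
    \<comment> \<open>For fixed \<open>t\<close> only the translate by \<open>t\<close> of the
      support of \<open>g\<close> contributes, and left translation is injective.\<close>
    have "(\<Sum>s\<in>K. h s (f t * \<alpha> t (g (inv\<^bsub>G\<^esub> t \<otimes> s)))) =
      (\<Sum>s\<in>(\<otimes>) t ` {r. g r \<noteq> 0}. h s (f t * \<alpha> t (g (inv\<^bsub>G\<^esub> t \<otimes> s))))"
    proof (rule sum.mono_neutral_right)
      show "(\<otimes>) t ` {r. g r \<noteq> 0} \<subseteq> K" using t by (auto simp: K_def)
      show "\<forall>s\<in>K - (\<otimes>) t ` {r. g r \<noteq> 0}. h s (f t * \<alpha> t (g (inv\<^bsub>G\<^esub> t \<otimes> s))) = 0"
      proof
        fix s assume s: "s \<in> K - (\<otimes>) t ` {r. g r \<noteq> 0}"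
        then have "s = t \<otimes> (inv\<^bsub>G\<^esub> t \<otimes> s)"
          using tG KG[of s] by (simp add: m_assoc[symmetric])
        with s have "g (inv\<^bsub>G\<^esub> t \<otimes> s) = 0" by auto
        then show "h s (f t * \<alpha> t (g (inv\<^bsub>G\<^esub> t \<otimes> s))) = 0"
          by (simp add: action_simps(6)[OF tG] h)
      qed
    qed (rule fin)
    also have "\<dots> = (\<Sum>r | g r \<noteq> 0. h (t \<otimes> r) (f t * \<alpha> t (g (inv\<^bsub>G\<^esub> t \<otimes> (t \<otimes> r)))))"
      by (subst sum.reindex) (use tG gG in \<open>auto simp: inj_on_def\<close>)
    also have "\<dots> = (\<Sum>r | g r \<noteq> 0. h (t \<otimes> r) (f t * \<alpha> t (g r)))"
      by (intro sum.cong) (use tG gG in \<open>auto simp: m_assoc[symmetric]\<close>)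
    finally show "(\<Sum>s\<in>K. h s (f t * \<alpha> t (g (inv\<^bsub>G\<^esub> t \<otimes> s)))) =
      (\<Sum>r | g r \<noteq> 0. h (t \<otimes> r) (f t * \<alpha> t (g r)))" .
  qed
  finally show ?thesis .
qed

lemma Cc_star_support:
  assumes "Cc_star G \<alpha> f s \<noteq> 0"
  shows "s \<in> m_inv G ` {r. f r \<noteq> 0}"
proof -
  have s: "s \<in> carrier G" "\<alpha> s (star (f (inv\<^bsub>G\<^esub> s))) \<noteq> 0"
    using assms by (auto simp: Cc_star_def split: if_splits)
  then have "f (inv\<^bsub>G\<^esub> s) \<noteq> 0" by (auto simp: action_simps(6))
  moreover have "s = inv\<^bsub>G\<^esub> (inv\<^bsub>G\<^esub> s)" using s by simp
  ultimately show ?thesis by blast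
qed

lemma Cc_star_closed:
  assumes f: "f \<in> Cc G"
  shows "Cc_star G \<alpha> f \<in> Cc G"
proof -
  have "finite {s. Cc_star G \<alpha> f s \<noteq> 0}"
    by (rule finite_subset[OF subsetI[OF Cc_star_support]]) (use f in \<open>auto simp: Cc_def\<close>)
  then show ?thesis by (auto simp: Cc_def Cc_star_def split: if_splits)
qed

text \<open>Reindexing by inversion cancels the double inverse that arises from
  \<open>Cc_star\<close>.\<close>

lemma Cc_sum_star:
  assumes f: "f \<in> Cc G" and h: "\<And>s. h s 0 = 0"
  shows "Cc_sum h (Cc_star G \<alpha> f) =
    (\<Sum>r | f r \<noteq> 0. h (inv\<^bsub>G\<^esub> r) (\<alpha> (inv\<^bsub>G\<^esub> r) (star (f r))))"
proof -
  have fin: "finite {r. f r \<noteq> 0}" and fG: "\<And>r. f r \<noteq> 0 \<Longrightarrow> r \<in> carrier G"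
    using f by (auto simp: Cc_def)
  have "Cc_sum h (Cc_star G \<alpha> f) =
      (\<Sum>s\<in>m_inv G ` {r. f r \<noteq> 0}. h s (Cc_star G \<alpha> f s))"
    by (rule Cc_sum_superset) (use fin Cc_star_support h in auto)
  also have "\<dots> = (\<Sum>r | f r \<noteq> 0. h (inv\<^bsub>G\<^esub> r) (Cc_star G \<alpha> f (inv\<^bsub>G\<^esub> r)))"
    by (subst sum.reindex) (use fG in \<open>auto simp: inj_on_def dest: inv_inj[THEN inj_onD]\<close>)
  also have "\<dots> = (\<Sum>r | f r \<noteq> 0. h (inv\<^bsub>G\<^esub> r) (\<alpha> (inv\<^bsub>G\<^esub> r) (star (f r))))"
    by (intro sum.cong) (use fG in \<open>auto simp: Cc_star_def\<close>)
  finally show ?thesis .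
qed

end


section \<open>The seminorm defined by an invariant state\<close>

locale invariant_state = cstar_dynamical_system G \<alpha> + state \<phi>
  for G :: "('g, 'm) monoid_scheme" (structure)
    and \<alpha> :: "'g \<Rightarrow> 'a::unital_cstar_algebra \<Rightarrow> 'a" and \<phi> :: "'a \<Rightarrow> complex" +
  assumes invariant: "s \<in> carrier G \<Longrightarrow> \<phi> (\<alpha> s a) = \<phi> a"
begin

text \<open>The GNS construction without the Hilbert space: the algebra itself carries the
  semi-inner product \<open>\<phi> (star y * x)\<close>.\<close>

definition act :: "('g \<Rightarrow> 'a) \<Rightarrow> 'a \<Rightarrow> 'a" where
  "act f x = Cc_sum (\<lambda>s a. a * \<alpha> s x) f"

text \<open>The operator seminorm of \<open>act f\<close> relative to \<open>nrm\<close>. Taking the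
  infimum of the admissible constants avoids dividing by \<open>nrm x\<close>, which may vanish for
  nonzero \<open>x\<close>.\<close>

definition p :: "('g \<Rightarrow> 'a) \<Rightarrow> real" where
  "p f = Inf {c. 0 \<le> c \<and> (\<forall>x. nrm (act f x) \<le> c * nrm x)}"

text \<open>Invariance of \<open>\<phi>\<close> makes each \<open>\<alpha> s\<close> isometric;
  these maps play the role of the unitaries implementing the group on the GNS space.\<close>

lemma nrm_action: "s \<in> carrier G \<Longrightarrow> nrm (\<alpha> s x) = nrm x"
  using invariant[of s "star x * x"] by (simp add: nrm_def action_simps)

text \<open>The l1-norm of \<open>f\<close> is one admissible constant, so the infimum in
  \<open>p\<close> is taken over a nonempty set.\<close>

lemma act_bounded:
  assumes f: "f \<in> Cc G"
  shows "nrm (act f x) \<le> (\<Sum>s | f s \<noteq> 0. norm (f s)) * nrm x"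
proof -
  have "nrm (act f x) \<le> (\<Sum>s | f s \<noteq> 0. nrm (f s * \<alpha> s x))"
    unfolding act_def Cc_sum_def by (rule nrm_sum)
  also have "\<dots> \<le> (\<Sum>s | f s \<noteq> 0. norm (f s) * nrm x)"
  proof (rule sum_mono)
    fix s assume "s \<in> {s. f s \<noteq> 0}"
    then have "s \<in> carrier G" using f by (auto simp: Cc_def)
    then show "nrm (f s * \<alpha> s x) \<le> norm (f s) * nrm x"
      using nrm_mult[of "f s" "\<alpha> s x"] by (simp add: nrm_action)
  qed
  finally show ?thesis by (simp add: sum_distrib_right)
qed

lemma p_le:
  assumes "0 \<le> c" "\<And>x. nrm (act f x) \<le> c * nrm x"
  shows "p f \<le> c"
  unfolding p_def by (rule cInf_lower) (use assms in \<open>auto intro: bdd_belowI\<close>)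

lemma
  assumes f: "f \<in> Cc G"
  shows p_nonneg: "0 \<le> p f" and p_bound: "nrm (act f x) \<le> p f * nrm x"
proof -
  define C where "C = {c. 0 \<le> c \<and> (\<forall>x. nrm (act f x) \<le> c * nrm x)}"
  have "(\<Sum>s | f s \<noteq> 0. norm (f s)) \<in> C"
    using act_bounded[OF f] by (auto simp: C_def intro: sum_nonneg)
  then have ne: "C \<noteq> {}" by blast
  show "0 \<le> p f"
    unfolding p_def C_def[symmetric] using ne by (rule cInf_greatest) (simp add: C_def)
  show "nrm (act f x) \<le> p f * nrm x"
  proof (cases "nrm x = 0")
    case True
    \<comment> \<open>The l1-bound shows that \<open>act f\<close> maps null vectors to null
      vectors.\<close>
    then show ?thesis using act_bounded[OF f, of x] by simp
  next
    case False
    then have pos: "nrm x > 0" using nrm_nonneg[of x] by linarith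
    have "nrm (act f x) / nrm x \<le> p f"
      unfolding p_def C_def[symmetric] using ne
      by (rule cInf_greatest) (use pos in \<open>simp add: C_def field_simps\<close>)
    then show ?thesis using pos by (simp add: field_simps)
  qed
qed

section \<open>The action as a representation of the convolution algebra\<close>

lemma act_add:
  "f \<in> Cc G \<Longrightarrow> g \<in> Cc G \<Longrightarrow> act (\<lambda>s. f s + g s) x = act f x + act g x"
  unfolding act_def by (rule Cc_sum_add) (auto simp: algebra_simps)

lemma act_scale: "f \<in> Cc G \<Longrightarrow> act (\<lambda>s. c *\<^sub>C f s) x = c *\<^sub>C act f x"
  unfolding act_def by (rule Cc_sum_scale) (auto simp: scaleC_mult_left scaleC_add_right)

lemma action_sum: "s \<in> carrier G \<Longrightarrow> \<alpha> s (\<Sum>i\<in>I. x i) = (\<Sum>i\<in>I. \<alpha> s (x i))"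
  by (induction I rule: infinite_finite_induct) (simp_all add: action_simps)

text \<open>The covariance used is \<open>\<alpha> t (g r * \<alpha> r x) = \<alpha> t (g r) *
  \<alpha> (t \<otimes> r) x\<close>.\<close>

lemma act_mult:
  assumes f: "f \<in> Cc G" and g: "g \<in> Cc G"
  shows "act (Cc_mult G \<alpha> f g) x = act f (act g x)"
proof -
  have "act (Cc_mult G \<alpha> f g) x =
    (\<Sum>t | f t \<noteq> 0. \<Sum>r | g r \<noteq> 0. f t * \<alpha> t (g r) * \<alpha> (t \<otimes> r) x)"
    unfolding act_def by (rule Cc_sum_mult[OF f g]) (auto simp: algebra_simps)
  also have "\<dots> = (\<Sum>t | f t \<noteq> 0. f t * \<alpha> t (\<Sum>r | g r \<noteq> 0. g r * \<alpha> r x))"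
  proof (intro sum.cong refl)
    fix t assume "t \<in> {t. f t \<noteq> 0}"
    then have t: "t \<in> carrier G" using f by (auto simp: Cc_def)
    show "(\<Sum>r | g r \<noteq> 0. f t * \<alpha> t (g r) * \<alpha> (t \<otimes> r) x) =
      f t * \<alpha> t (\<Sum>r | g r \<noteq> 0. g r * \<alpha> r x)"
      unfolding action_sum[OF t] sum_distrib_left
      by (intro sum.cong) (use t g in \<open>auto simp: Cc_def action_mult action_simps mult.assoc\<close>)
  qed
  finally show ?thesis by (simp add: act_def Cc_sum_def)
qed

text \<open>Each summand crosses the form by applying the automorphism of the inverse of
  \<open>r\<close> inside the invariant \<open>\<phi>\<close>. So \<open>act\<close> respects
  adjoints for the GNS form.\<close>

lemma act_adjoint:
  assumes f: "f \<in> Cc G"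
  shows "\<phi> (star (act (Cc_star G \<alpha> f) y) * x) = \<phi> (star y * act f x)"
proof -
  have fG: "r \<in> carrier G" if "f r \<noteq> 0" for r using f that by (auto simp: Cc_def)
  have "act (Cc_star G \<alpha> f) y =
    (\<Sum>r | f r \<noteq> 0. \<alpha> (inv\<^bsub>G\<^esub> r) (star (f r)) * \<alpha> (inv\<^bsub>G\<^esub> r) y)"
    unfolding act_def by (rule Cc_sum_star[OF f]) simp
  then have "\<phi> (star (act (Cc_star G \<alpha> f) y) * x) =
    (\<Sum>r | f r \<noteq> 0. \<phi> (star (\<alpha> (inv\<^bsub>G\<^esub> r) (star (f r)) * \<alpha> (inv\<^bsub>G\<^esub> r) y) * x))"
    by (simp add: star_sum sum_distrib_right sum)
  also have "\<dots> = (\<Sum>r | f r \<noteq> 0. \<phi> (star y * (f r * \<alpha> r x)))"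
  proof (intro sum.cong refl)
    fix r assume "r \<in> {r. f r \<noteq> 0}"
    then have r: "r \<in> carrier G" using fG by auto
    have "star (\<alpha> (inv\<^bsub>G\<^esub> r) (star (f r)) * \<alpha> (inv\<^bsub>G\<^esub> r) y) * x =
      \<alpha> (inv\<^bsub>G\<^esub> r) (star y * (f r * \<alpha> r x))"
      using r by (simp add: action_simps action_inv star_mult star_star mult.assoc)
    then show "\<phi> (star (\<alpha> (inv\<^bsub>G\<^esub> r) (star (f r)) * \<alpha> (inv\<^bsub>G\<^esub> r) y) * x) =
      \<phi> (star y * (f r * \<alpha> r x))"
      using r by (simp add: invariant)
  qed
  also have "\<dots> = \<phi> (star y * act f x)"
    by (simp add: act_def Cc_sum_def sum_distrib_left sum)
  finally show ?thesis .
qed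

lemma nrm_act_sq:
  assumes f: "f \<in> Cc G"
  shows "of_real ((nrm (act f x))\<^sup>2) = \<phi> (star x * act (Cc_star G \<alpha> f) (act f x))"
proof -
  have "of_real ((nrm (act f x))\<^sup>2) = \<phi> (star (act f x) * act f x)"
    by (rule nrm_sq)
  also have "\<dots> = \<phi> (star (act (Cc_star G \<alpha> f) (act f x)) * x)"
    by (rule act_adjoint[OF f, symmetric])
  also have "\<dots> = cnj (\<phi> (star x * act (Cc_star G \<alpha> f) (act f x)))"
    by (rule hermitian)
  \<comment> \<open>The left side is real, so the conjugation drops out.\<close>
  finally show ?thesis
    by (metis complex_cnj_cnj complex_cnj_complex_of_real)
qed

section \<open>The C*-seminorm axioms for \<open>p\<close>\<close>

lemma p_add: "f \<in> Cc G \<Longrightarrow> g \<in> Cc G \<Longrightarrow> p (\<lambda>s. f s + g s) \<le> p f + p g"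
  by (rule p_le) (auto simp: act_add p_nonneg distrib_right
      intro: order.trans[OF nrm_add add_mono[OF p_bound p_bound]])

text \<open>One inequality holds for every scalar; applied to \<open>1 / c\<close> it yields the
  reverse one.\<close>

lemma p_scale:
  assumes f: "f \<in> Cc G"
  shows "p (\<lambda>s. c *\<^sub>C f s) = cmod c * p f"
proof -
  have le: "p (\<lambda>s. d *\<^sub>C g s) \<le> cmod d * p g" if g: "g \<in> Cc G" for d g
    by (rule p_le) (auto simp: act_scale g nrm_scaleC p_nonneg mult.assoc
        intro!: mult_left_mono p_bound)
  show ?thesis
  proof (cases "c = 0")
    case True
    then show ?thesis
      using le[OF f, of c] p_nonneg[OF Cc_scale[OF f, of c]] by simp
  next
    case False
    have "p f \<le> cmod (1 / c) * p (\<lambda>s. c *\<^sub>C f s)"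
      using le[OF Cc_scale[OF f, of c], of "1 / c"] False by (simp add: scaleC_scaleC)
    then have "cmod c * p f \<le> p (\<lambda>s. c *\<^sub>C f s)"
      using False by (simp add: norm_divide field_simps)
    then show ?thesis using le[OF f, of c] by simp
  qed
qed

lemma p_mult:
  assumes f: "f \<in> Cc G" and g: "g \<in> Cc G"
  shows "p (Cc_mult G \<alpha> f g) \<le> p f * p g"
proof (rule p_le)
  fix x
  have "nrm (act f (act g x)) \<le> p f * nrm (act g x)" by (rule p_bound[OF f])
  also have "\<dots> \<le> p f * (p g * nrm x)"
    by (intro mult_left_mono p_bound g p_nonneg f)
  finally show "nrm (act (Cc_mult G \<alpha> f g) x) \<le> p f * p g * nrm x"
    by (simp add: act_mult f g)
qed (simp add: p_nonneg f g)

text \<open>For \<open>y = act (Cc_star G \<alpha> f) x\<close>, adjointness and Cauchy-Schwarz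
  bound \<open>(nrm y)\<^sup>2\<close> by \<open>p f * nrm x * nrm y\<close>, and one factor
  cancels.\<close>

lemma p_star_le:
  assumes f: "f \<in> Cc G"
  shows "p (Cc_star G \<alpha> f) \<le> p f"
proof (rule p_le[OF p_nonneg[OF f]])
  fix x
  let ?y = "act (Cc_star G \<alpha> f) x"
  have "of_real ((nrm ?y)\<^sup>2) = \<phi> (star x * act f ?y)"
    using act_adjoint[OF f, of x ?y] by (simp only: nrm_sq)
  then have "(nrm ?y)\<^sup>2 = cmod (\<phi> (star x * act f ?y))"
    by (metis norm_of_real abs_of_nonneg zero_le_power2)
  also have "\<dots> \<le> nrm x * nrm (act f ?y)" by (rule cauchy_schwarz)
  also have "\<dots> \<le> nrm x * (p f * nrm ?y)" by (intro mult_left_mono p_bound f) simp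
  finally have "nrm ?y * nrm ?y \<le> (p f * nrm x) * nrm ?y"
    by (simp add: power2_eq_square mult_ac)
  then show "nrm ?y \<le> p f * nrm x"
    using nrm_nonneg[of ?y] p_nonneg[OF f] nrm_nonneg[of x]
    by (cases "nrm ?y = 0") (auto simp: mult_le_cancel_right)
qed

text \<open>One inequality is submultiplicativity combined with \<open>p_star_le\<close>. For the
  other, \<open>(nrm (act f x))\<^sup>2\<close> is a matrix coefficient of the product of
  \<open>f\<close> with its adjoint, which Cauchy-Schwarz bounds.\<close>

lemma p_cstar:
  assumes f: "f \<in> Cc G"
  shows "p (Cc_mult G \<alpha> (Cc_star G \<alpha> f) f) = (p f)\<^sup>2"
proof (rule antisym)
  let ?g = "Cc_mult G \<alpha> (Cc_star G \<alpha> f) f"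
  have sG: "Cc_star G \<alpha> f \<in> Cc G" by (rule Cc_star_closed[OF f])
  then have gG: "?g \<in> Cc G" by (rule Cc_mult_closed[OF _ f])
  have "p ?g \<le> p (Cc_star G \<alpha> f) * p f" by (rule p_mult[OF sG f])
  also have "\<dots> \<le> p f * p f" by (intro mult_right_mono p_star_le f p_nonneg)
  finally show "p ?g \<le> (p f)\<^sup>2" by (simp add: power2_eq_square)
  have "p f \<le> sqrt (p ?g)"
  proof (rule p_le)
    fix x
    have "(nrm (act f x))\<^sup>2 = cmod (\<phi> (star x * act ?g x))"
      using nrm_act_sq[OF f, of x] act_mult[OF sG f, of x]
      by (metis norm_of_real abs_of_nonneg zero_le_power2)
    also have "\<dots> \<le> nrm x * nrm (act ?g x)" by (rule cauchy_schwarz)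
    also have "\<dots> \<le> nrm x * (p ?g * nrm x)" by (intro mult_left_mono p_bound gG) simp
    also have "\<dots> = (sqrt (p ?g) * nrm x)\<^sup>2"
      by (simp add: power_mult_distrib p_nonneg gG power2_eq_square[of "nrm x"])
    finally show "nrm (act f x) \<le> sqrt (p ?g) * nrm x"
      by (rule power2_le_imp_le) (simp add: p_nonneg gG)
  qed (simp add: p_nonneg gG)
  then have "(p f)\<^sup>2 \<le> (sqrt (p ?g))\<^sup>2" by (intro power_mono p_nonneg f)
  then show "(p f)\<^sup>2 \<le> p ?g" by (simp add: p_nonneg gG)
qed

text \<open>This brings \<open>p\<close> under the maximality clause of
  \<open>full_crossed_product\<close>, so the norm of the crossed product dominates it.\<close>

lemma cstar_seminorm_p: "cstar_seminorm G \<alpha> p"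
  by (simp add: cstar_seminorm_def p_nonneg p_add p_scale p_mult p_cstar)

text \<open>Every \<open>\<alpha> s\<close> fixes \<open>1\<close>, so \<open>act f 1\<close> is the
  sum of the coefficients of \<open>f\<close>. The linear extension of \<open>\<phi>\<close> is thus
  the vector functional of the cyclic vector \<open>1\<close>.\<close>

lemma Cc_sum_eq_act:
  assumes f: "f \<in> Cc G"
  shows "Cc_sum (\<lambda>_. \<phi>) f = \<phi> (act f 1)"
  unfolding Cc_sum_def act_def sum
  by (intro sum.cong) (use f in \<open>auto simp: Cc_def action_simps\<close>)

lemma Cc_sum_le_p:
  assumes f: "f \<in> Cc G"
  shows "cmod (Cc_sum (\<lambda>_. \<phi>) f) \<le> p f"
  using cauchy_schwarz[of 1 "act f 1"] p_bound[OF f, of 1] by (simp add: Cc_sum_eq_act[OF f])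

lemma Cc_sum_star_mult_nonneg:
  assumes f: "f \<in> Cc G"
  shows "Cc_sum (\<lambda>_. \<phi>) (Cc_mult G \<alpha> (Cc_star G \<alpha> f) f) \<in> \<real>\<^sub>\<ge>\<^sub>0"
proof -
  have "Cc_sum (\<lambda>_. \<phi>) (Cc_mult G \<alpha> (Cc_star G \<alpha> f) f) = of_real ((nrm (act f 1))\<^sup>2)"
    using nrm_act_sq[OF f, of 1]
    by (simp add: Cc_sum_eq_act Cc_mult_closed Cc_star_closed f act_mult)
  then show ?thesis by (simp add: complex_nonneg_Reals_iff)
qed

end

lemma (in cstar_dynamical_system) invariant_states_iff:
  "\<phi> \<in> invariant_states G \<alpha> \<longleftrightarrow> invariant_state G \<alpha> \<phi>"
  using cstar_dynamical_system_axioms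
  by (auto simp: invariant_states_def invariant_state_def invariant_state_axioms_def states_iff_state)


section \<open>States of the crossed product\<close>

locale crossed_product = cstar_dynamical_system G \<alpha>
  for G :: "('g, 'm) monoid_scheme" (structure)
    and \<alpha> :: "'g \<Rightarrow> 'a::unital_cstar_algebra \<Rightarrow> 'a" +
  fixes \<iota> :: "'a \<Rightarrow> 'b::unital_cstar_algebra" and u :: "'g \<Rightarrow> 'b"
  assumes crossed: "full_crossed_product G \<alpha> \<iota> u"
begin

section \<open>Algebra of the canonical map into the crossed product\<close>

lemma iota_hom: "unital_star_hom \<iota>"
  using crossed by (simp add: full_crossed_product_def)

lemmas iota_simps = unital_star_homD[OF iota_hom]

lemma u_unitary: "s \<in> carrier G \<Longrightarrow> unitary (u s)"
  and u_mult: "s \<in> carrier G \<Longrightarrow> t \<in> carrier G \<Longrightarrow> u (s \<otimes> t) = u s * u t"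
  and u_conj: "s \<in> carrier G \<Longrightarrow> u s * \<iota> a * star (u s) = \<iota> (\<alpha> s a)"
  and dense: "closure (Cc_map \<iota> u ` Cc G) = UNIV"
  and seminorm_le: "cstar_seminorm G \<alpha> q \<Longrightarrow> f \<in> Cc G \<Longrightarrow> q f \<le> norm (Cc_map \<iota> u f)"
  using crossed by (auto simp: full_crossed_product_def)

lemma star_u_mult [simp]: "s \<in> carrier G \<Longrightarrow> star (u s) * u s = 1"
  and u_mult_star [simp]: "s \<in> carrier G \<Longrightarrow> u s * star (u s) = 1"
  using u_unitary by (auto simp: unitary_def)

lemma u_iota: "s \<in> carrier G \<Longrightarrow> u s * \<iota> a = \<iota> (\<alpha> s a) * u s"
  by (simp add: u_conj[symmetric] mult.assoc)

lemma u_one: "u \<one> = 1"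
  using arg_cong[OF u_mult[of \<one> \<one>], of "\<lambda>x. star (u \<one>) * x"]
  by (simp flip: mult.assoc)

lemma u_inv: "s \<in> carrier G \<Longrightarrow> u (inv\<^bsub>G\<^esub> s) = star (u s)"
  using arg_cong[OF u_mult[of "inv\<^bsub>G\<^esub> s" s], of "\<lambda>x. x * star (u s)"]
  by (simp add: u_one mult.assoc)

lemma Cc_map_eq: "Cc_map \<iota> u = Cc_sum (\<lambda>s a. \<iota> a * u s)"
  by (simp add: Cc_map_def Cc_sum_def fun_eq_iff)

lemma Cc_map_add:
  "f \<in> Cc G \<Longrightarrow> g \<in> Cc G \<Longrightarrow> Cc_map \<iota> u (\<lambda>s. f s + g s) = Cc_map \<iota> u f + Cc_map \<iota> u g"
  unfolding Cc_map_eq by (rule Cc_sum_add) (auto simp: iota_simps algebra_simps)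

lemma Cc_map_scale: "f \<in> Cc G \<Longrightarrow> Cc_map \<iota> u (\<lambda>s. c *\<^sub>C f s) = c *\<^sub>C Cc_map \<iota> u f"
  unfolding Cc_map_eq
  by (rule Cc_sum_scale) (auto simp: iota_simps scaleC_mult_left scaleC_add_right)

lemma Cc_map_mult:
  assumes f: "f \<in> Cc G" and g: "g \<in> Cc G"
  shows "Cc_map \<iota> u (Cc_mult G \<alpha> f g) = Cc_map \<iota> u f * Cc_map \<iota> u g"
proof -
  have "Cc_map \<iota> u (Cc_mult G \<alpha> f g) =
    (\<Sum>t | f t \<noteq> 0. \<Sum>r | g r \<noteq> 0. \<iota> (f t * \<alpha> t (g r)) * u (t \<otimes> r))"
    unfolding Cc_map_eq by (rule Cc_sum_mult[OF f g]) (auto simp: iota_simps algebra_simps)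
  also have "\<dots> = (\<Sum>t | f t \<noteq> 0. \<Sum>r | g r \<noteq> 0. (\<iota> (f t) * u t) * (\<iota> (g r) * u r))"
  proof (rule sum.cong[OF refl], rule sum.cong[OF refl])
    fix t r assume "t \<in> {t. f t \<noteq> 0}" "r \<in> {r. g r \<noteq> 0}"
    then have t: "t \<in> carrier G" and r: "r \<in> carrier G" using f g by (auto simp: Cc_def)
    have "(\<iota> (f t) * u t) * (\<iota> (g r) * u r) = \<iota> (f t) * (u t * \<iota> (g r)) * u r"
      by (simp add: mult.assoc)
    then show "\<iota> (f t * \<alpha> t (g r)) * u (t \<otimes> r) = (\<iota> (f t) * u t) * (\<iota> (g r) * u r)"
      by (simp add: u_iota[OF t] u_mult[OF t r] iota_simps mult.assoc)
  qed
  finally show ?thesis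
    by (simp add: Cc_map_def sum_product)
qed

lemma Cc_map_star:
  assumes f: "f \<in> Cc G"
  shows "Cc_map \<iota> u (Cc_star G \<alpha> f) = star (Cc_map \<iota> u f)"
proof -
  have "Cc_map \<iota> u (Cc_star G \<alpha> f) =
    (\<Sum>r | f r \<noteq> 0. \<iota> (\<alpha> (inv\<^bsub>G\<^esub> r) (star (f r))) * u (inv\<^bsub>G\<^esub> r))"
    unfolding Cc_map_eq by (rule Cc_sum_star[OF f]) (simp add: iota_simps)
  also have "\<dots> = (\<Sum>r | f r \<noteq> 0. star (\<iota> (f r) * u r))"
  proof (rule sum.cong[OF refl])
    fix r assume "r \<in> {r. f r \<noteq> 0}"
    then have r: "r \<in> carrier G" using f by (auto simp: Cc_def)
    have "\<iota> (\<alpha> (inv\<^bsub>G\<^esub> r) (star (f r))) * u (inv\<^bsub>G\<^esub> r) = u (inv\<^bsub>G\<^esub> r) * \<iota> (star (f r))"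
      by (rule u_iota[symmetric]) (use r in simp)
    then show "\<iota> (\<alpha> (inv\<^bsub>G\<^esub> r) (star (f r))) * u (inv\<^bsub>G\<^esub> r) = star (\<iota> (f r) * u r)"
      by (simp add: u_inv r star_mult iota_simps)
  qed
  finally show ?thesis by (simp add: Cc_map_def star_sum)
qed

text \<open>Point masses, here at the identity, allow values of a functional on \<open>A\<close> to
  be read off from its values on \<open>Cc G\<close>.\<close>

lemma iota_eq_Cc_map: "\<iota> a = Cc_map \<iota> u (\<lambda>t. if t = \<one> then a else 0)"
  unfolding Cc_map_eq by (subst Cc_sum_single) (simp_all add: iota_simps u_one)

lemma u_eq_Cc_map: "u s = Cc_map \<iota> u (\<lambda>t. if t = s then 1 else 0)"
  unfolding Cc_map_eq by (subst Cc_sum_single) (simp_all add: iota_simps)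

lemma dense_induct:
  assumes "closed {x. P x}" "\<And>f. f \<in> Cc G \<Longrightarrow> P (Cc_map \<iota> u f)"
  shows "P x"
proof -
  have "closure (Cc_map \<iota> u ` Cc G) \<subseteq> {x. P x}"
    by (rule closure_minimal) (use assms in auto)
  then show ?thesis using dense by auto
qed

section \<open>Restriction and extension of states\<close>

lemma S1_state: "\<psi> \<in> S1 G u \<Longrightarrow> state \<psi>"
  and S1_u: "\<psi> \<in> S1 G u \<Longrightarrow> s \<in> carrier G \<Longrightarrow> \<psi> (u s) = 1"
  by (auto simp: S1_def states_iff_state)

text \<open>Each \<open>u s\<close> lies in the multiplicative domain of \<open>\<psi>\<close>, so
  the factors \<open>u s\<close> disappear. Injectivity of the restriction and continuity of its
  inverse both rest on this formula.\<close>

lemma S1_Cc_map: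
  assumes \<psi>: "\<psi> \<in> S1 G u" and f: "f \<in> Cc G"
  shows "\<psi> (Cc_map \<iota> u f) = Cc_sum (\<lambda>_. restriction \<iota> \<psi>) f"
proof -
  interpret state \<psi> by (rule S1_state[OF \<psi>])
  show ?thesis
    unfolding Cc_map_def Cc_sum_def sum restriction_def
    by (intro sum.cong)
      (use f in \<open>auto simp: Cc_def intro!: mult_unitary_right u_unitary S1_u[OF \<psi>]\<close>)
qed

text \<open>In \<open>\<iota> (\<alpha> s a) * u s = u s * \<iota> a\<close> the state ignores
  \<open>u s\<close> on both sides.\<close>

lemma restriction_S1:
  assumes \<psi>: "\<psi> \<in> S1 G u"
  shows "restriction \<iota> \<psi> \<in> invariant_states G \<alpha>"
proof -
  interpret state \<psi> by (rule S1_state[OF \<psi>])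
  have "state (restriction \<iota> \<psi>)"
  proof
    fix x show "restriction \<iota> \<psi> (star x * x) \<in> \<real>\<^sub>\<ge>\<^sub>0"
      using nonneg[of "\<iota> x"] by (simp add: restriction_def iota_simps)
  qed (simp_all add: restriction_def iota_simps add scaleC)
  moreover have "restriction \<iota> \<psi> (\<alpha> s a) = restriction \<iota> \<psi> a" if s: "s \<in> carrier G" for s a
  proof -
    note us = u_unitary[OF s] S1_u[OF \<psi> s]
    have "\<psi> (\<iota> (\<alpha> s a)) = \<psi> (\<iota> (\<alpha> s a) * u s)"
      by (rule mult_unitary_right[OF us, symmetric])
    also have "\<dots> = \<psi> (u s * \<iota> a)" by (simp add: u_iota s)
    also have "\<dots> = \<psi> (\<iota> a)" by (rule mult_unitary_left[OF us])
    finally show ?thesis by (simp add: restriction_def)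
  qed
  ultimately show ?thesis by (simp add: invariant_states_def states_iff_state)
qed

lemma continuous_on_S1: "\<psi> \<in> S1 G u \<Longrightarrow> continuous_on X \<psi>"
  using positive_functional.bounded_linear S1_state
  by (auto simp: state_def intro: linear_continuous_on)

lemma inj_restriction: "inj_on (restriction \<iota>) (S1 G u)"
proof (rule inj_onI, rule ext)
  fix \<psi> \<rho> x assume \<psi>: "\<psi> \<in> S1 G u" and \<rho>: "\<rho> \<in> S1 G u"
    and eq: "restriction \<iota> \<psi> = restriction \<iota> \<rho>"
  show "\<psi> x = \<rho> x"
  proof (rule dense_induct[where P = "\<lambda>x. \<psi> x = \<rho> x"])
    show "closed {x. \<psi> x = \<rho> x}"
      by (intro closed_Collect_eq continuous_on_S1 \<psi> \<rho>)
  qed (simp add: S1_Cc_map \<psi> \<rho> eq)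
qed

text \<open>The linear extension of \<open>\<phi>\<close> to \<open>Cc G\<close> is bounded by the
  GNS seminorm, hence by the universal norm. It therefore factors through \<open>Cc_map\<close>, and
  the result extends by continuity.\<close>

lemma invariant_state_extension:
  assumes \<phi>: "\<phi> \<in> invariant_states G \<alpha>"
  shows "\<phi> \<in> restriction \<iota> ` S1 G u"
proof -
  interpret \<phi>: invariant_state G \<alpha> \<phi>
    using \<phi> by (simp add: invariant_states_iff)
  define \<Phi> where "\<Phi> = Cc_sum (\<lambda>_::'g. \<phi>)"
  define D where "D = Cc_map \<iota> u ` Cc G"
  have \<Phi>_add: "\<Phi> (\<lambda>s. f s + g s) = \<Phi> f + \<Phi> g" if "f \<in> Cc G" "g \<in> Cc G" for f g
    unfolding \<Phi>_def by (rule Cc_sum_add) (use that in \<open>auto simp: \<phi>.add\<close>)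
  have \<Phi>_scale: "\<Phi> (\<lambda>s. c *\<^sub>C f s) = c * \<Phi> f" if "f \<in> Cc G" for c f
    unfolding \<Phi>_def by (rule Cc_sum_scale) (use that in \<open>auto simp: \<phi>.scaleC algebra_simps\<close>)
  have bound: "dist (\<Phi> f) (\<Phi> g) \<le> dist (Cc_map \<iota> u f) (Cc_map \<iota> u g)"
    if f: "f \<in> Cc G" and g: "g \<in> Cc G" for f g
  proof -
    let ?d = "\<lambda>s. f s + (-1) *\<^sub>C g s"
    have m1: "(-1) *\<^sub>C x = - x" for x :: 'b
      using scaleR_scaleC[of "-1" x] by simp
    have d: "?d \<in> Cc G" by (intro Cc_add Cc_scale f g)
    have "cmod (\<Phi> ?d) \<le> norm (Cc_map \<iota> u ?d)"
      unfolding \<Phi>_def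
      using \<phi>.Cc_sum_le_p[OF d] seminorm_le[OF \<phi>.cstar_seminorm_p d] by linarith
    then show ?thesis
      by (simp add: \<Phi>_add \<Phi>_scale Cc_map_add Cc_map_scale Cc_scale f g m1 dist_norm)
  qed
  \<comment> \<open>A preimage is chosen; \<open>bound\<close> shows that the value does not depend
    on the choice.\<close>
  define g0 where "g0 d = \<Phi> (inv_into (Cc G) (Cc_map \<iota> u) d)" for d
  have g0: "g0 (Cc_map \<iota> u f) = \<Phi> f" if f: "f \<in> Cc G" for f
  proof -
    let ?f' = "inv_into (Cc G) (Cc_map \<iota> u) (Cc_map \<iota> u f)"
    have "?f' \<in> Cc G" "Cc_map \<iota> u ?f' = Cc_map \<iota> u f"
      by (rule inv_into_into[OF imageI[OF f]], rule f_inv_into_f[OF imageI[OF f]])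
    then show ?thesis using bound[of ?f' f] f by (simp add: g0_def)
  qed
  have "1-lipschitz_on D g0"
    \<comment> \<open>The Lipschitz extension to the closure of \<open>D\<close> is defined
      everywhere, since \<open>D\<close> is dense.\<close>
    by (rule lipschitz_onI) (auto simp: D_def g0 bound)
  then obtain \<psi> where lip: "1-lipschitz_on UNIV \<psi>" and \<psi>D: "\<And>x. x \<in> D \<Longrightarrow> \<psi> x = g0 x"
    using lipschitz_extend_closure[of 1 D g0] dense by (auto simp: D_def)
  have cont: "continuous_on X \<psi>" for X
    using lipschitz_on_continuous_on[OF lip] continuous_on_subset by blast
  note cont_comp = continuous_on_compose2[OF cont[of UNIV] _ subset_UNIV]
  have \<psi>: "\<psi> (Cc_map \<iota> u f) = \<Phi> f" if "f \<in> Cc G" for f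
    using \<psi>D[of "Cc_map \<iota> u f"] g0 that by (simp add: D_def)
  have \<psi>_iota: "\<psi> (\<iota> a) = \<phi> a" for a
    by (subst iota_eq_Cc_map) (simp add: \<psi> Cc_single \<Phi>_def Cc_sum_single)
  have \<psi>_u: "\<psi> (u s) = 1" if "s \<in> carrier G" for s
    by (subst u_eq_Cc_map) (simp add: \<psi> Cc_single that \<Phi>_def Cc_sum_single)
  have "state \<psi>"
  proof
    \<comment> \<open>Density is applied once in each variable.\<close>
    show "\<psi> (x + y) = \<psi> x + \<psi> y" for x y
    proof (rule dense_induct[where P = "\<lambda>x. \<psi> (x + y) = \<psi> x + \<psi> y"])
      show "closed {x. \<psi> (x + y) = \<psi> x + \<psi> y}"
        by (intro closed_Collect_eq continuous_intros cont cont_comp)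
      fix f :: "'g \<Rightarrow> 'a" assume f: "f \<in> Cc G"
      show "\<psi> (Cc_map \<iota> u f + y) = \<psi> (Cc_map \<iota> u f) + \<psi> y"
      proof (rule dense_induct[where P = "\<lambda>y. \<psi> (Cc_map \<iota> u f + y) = \<psi> (Cc_map \<iota> u f) + \<psi> y"])
        show "closed {y. \<psi> (Cc_map \<iota> u f + y) = \<psi> (Cc_map \<iota> u f) + \<psi> y}"
          by (intro closed_Collect_eq continuous_intros cont cont_comp)
      qed (simp add: \<psi> f \<Phi>_add Cc_add flip: Cc_map_add)
    qed
    show "\<psi> (c *\<^sub>C x) = c * \<psi> x" for c x
    proof (rule dense_induct[where P = "\<lambda>x. \<psi> (c *\<^sub>C x) = c * \<psi> x"])
      show "closed {x. \<psi> (c *\<^sub>C x) = c * \<psi> x}"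
        by (intro closed_Collect_eq continuous_intros cont cont_comp
            linear_continuous_on bounded_linear_scaleC)
    qed (simp add: \<psi> \<Phi>_scale Cc_scale flip: Cc_map_scale)
    show "\<psi> (star x * x) \<in> \<real>\<^sub>\<ge>\<^sub>0" for x
    proof (rule dense_induct[where P = "\<lambda>x. \<psi> (star x * x) \<in> \<real>\<^sub>\<ge>\<^sub>0"])
      have "closed ((\<lambda>x. \<psi> (star x * x)) -` \<real>\<^sub>\<ge>\<^sub>0)"
        by (intro closed_vimage closed_nonneg_Reals_complex cont_comp continuous_intros
            linear_continuous_on bounded_linear_star)
      then show "closed {x. \<psi> (star x * x) \<in> \<real>\<^sub>\<ge>\<^sub>0}" by (simp add: vimage_def)
      fix f :: "'g \<Rightarrow> 'a" assume f: "f \<in> Cc G"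
      then show "\<psi> (star (Cc_map \<iota> u f) * Cc_map \<iota> u f) \<in> \<real>\<^sub>\<ge>\<^sub>0"
        using \<phi>.Cc_sum_star_mult_nonneg[OF f]
        by (simp add: \<psi> Cc_mult_closed Cc_star_closed \<Phi>_def flip: Cc_map_star Cc_map_mult)
    qed
    show "\<psi> 1 = 1" using \<psi>_u[of \<one>] by (simp add: u_one)
  qed
  then have "\<psi> \<in> S1 G u" by (simp add: S1_def states_iff_state \<psi>_u)
  moreover have "\<phi> = restriction \<iota> \<psi>" by (simp add: restriction_def \<psi>_iota fun_eq_iff)
  ultimately show ?thesis by blast
qed

lemma restriction_image_S1: "restriction \<iota> ` S1 G u = invariant_states G \<alpha>"
  using restriction_S1 invariant_state_extension by blast

end


section \<open>The homeomorphisms\<close>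

lemma topspace_weak_star [simp]: "topspace (weak_star K) = K"
  by (simp add: weak_star_def)

lemma continuous_map_eval: "continuous_map (weak_star K) euclidean (\<lambda>\<phi>. \<phi> x)"
  unfolding weak_star_def
  by (intro continuous_map_from_subtopology continuous_map_product_projection) simp

lemma continuous_map_into_weak_star:
  assumes "F ` topspace X \<subseteq> K" "\<And>x. continuous_map X euclidean (\<lambda>\<phi>. F \<phi> x)"
  shows "continuous_map X (weak_star K) F"
  using assms by (auto simp: weak_star_def continuous_map_in_subtopology
      continuous_map_componentwise_UNIV)

lemma weak_star_subset: "L \<subseteq> K \<Longrightarrow> weak_star L = subtopology (weak_star K) L"
  by (simp add: weak_star_def subtopology_subtopology inf.absorb2)

context crossed_product
begin

text \<open>At a point of the dense subalgebra the inverse involves only finitely many values of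
  \<open>\<phi>\<close>, so its evaluation there is continuous. Contractivity of states makes the
  approximation at a general \<open>x\<close> uniform in \<open>\<phi>\<close>.\<close>

lemma homeomorphic_map_S1:
  "homeomorphic_map (weak_star (S1 G u)) (weak_star (invariant_states G \<alpha>)) (restriction \<iota>)"
proof -
  define E where "E = inv_into (S1 G u) (restriction \<iota>)"
  have E: "E \<phi> \<in> S1 G u" and RE: "restriction \<iota> (E \<phi>) = \<phi>" if "\<phi> \<in> invariant_states G \<alpha>" for \<phi>
    using that inv_into_into[of \<phi> "restriction \<iota>" "S1 G u"] f_inv_into_f[of \<phi> "restriction \<iota>" "S1 G u"]
    by (auto simp: E_def restriction_image_S1)
  have ER: "E (restriction \<iota> \<psi>) = \<psi>" if "\<psi> \<in> S1 G u" for \<psi>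
    using that inj_restriction by (simp add: E_def)
  have "continuous_map (weak_star (invariant_states G \<alpha>)) euclidean (\<lambda>\<phi>. E \<phi> x)" for x
  proof -
    have "x \<in> closure (Cc_map \<iota> u ` Cc G)" using dense by simp
    then obtain d where d: "\<forall>n. \<exists>g\<in>Cc G. d n = Cc_map \<iota> u g" "d \<longlonglongrightarrow> x"
      unfolding closure_sequential by blast
    from d(1) obtain f where f: "\<And>n. f n \<in> Cc G" "\<And>n. d n = Cc_map \<iota> u (f n)"
      by metis
    \<comment> \<open>\<open>Met_TC.mtopology\<close> is the usual topology of the complex numbers,
      in the form that the uniform limit theorem takes.\<close>
    have "continuous_map (weak_star (invariant_states G \<alpha>)) Met_TC.mtopology (\<lambda>\<phi>. E \<phi> x)"
    proof (rule Met_TC.continuous_map_uniform_limit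
        [where F = sequentially and f = "\<lambda>n \<phi>. Cc_sum (\<lambda>_. \<phi>) (f n)"])
      show "\<forall>\<^sub>F n in sequentially. continuous_map (weak_star (invariant_states G \<alpha>))
          Met_TC.mtopology (\<lambda>\<phi>. Cc_sum (\<lambda>_. \<phi>) (f n))"
        using f(1) unfolding Cc_sum_def
        by (intro always_eventually allI)
          (auto intro!: continuous_map_sum continuous_map_eval simp: Cc_def)
      fix \<epsilon> :: real assume "0 < \<epsilon>"
      with d(2) have "\<forall>\<^sub>F n in sequentially. dist (d n) x < \<epsilon>" by (rule tendstoD)
      then show "\<forall>\<^sub>F n in sequentially. \<forall>\<phi>\<in>topspace (weak_star (invariant_states G \<alpha>)).
          E \<phi> x \<in> UNIV \<and> dist (Cc_sum (\<lambda>_. \<phi>) (f n)) (E \<phi> x) < \<epsilon>"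
      proof eventually_elim
        case (elim n)
        show ?case
        proof (intro ballI conjI UNIV_I)
          fix \<phi> assume "\<phi> \<in> topspace (weak_star (invariant_states G \<alpha>))"
          then have \<phi>: "\<phi> \<in> invariant_states G \<alpha>" by simp
          interpret state "E \<phi>" by (rule S1_state[OF E[OF \<phi>]])
          have "Cc_sum (\<lambda>_. \<phi>) (f n) = E \<phi> (d n)"
            by (simp add: f S1_Cc_map E RE \<phi>)
          then have "dist (Cc_sum (\<lambda>_. \<phi>) (f n)) (E \<phi> x) = cmod (E \<phi> (d n - x))"
            by (simp add: dist_norm diff)
          also have "\<dots> \<le> dist (d n) x" using contractive by (simp add: dist_norm)
          finally show "dist (Cc_sum (\<lambda>_. \<phi>) (f n)) (E \<phi> x) < \<epsilon>" using elim by simp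
        qed
      qed
    qed simp
    then show ?thesis by simp
  qed
  then have "homeomorphic_maps (weak_star (S1 G u)) (weak_star (invariant_states G \<alpha>))
      (restriction \<iota>) E"
    unfolding homeomorphic_maps_def
    by (auto simp: E RE ER restriction_S1 intro!: continuous_map_into_weak_star)
      (auto simp: restriction_def intro: continuous_map_eval)
  then show ?thesis by (auto simp: homeomorphic_map_maps)
qed

text \<open>\<open>S1 G u\<close> is a face of the state space, because \<open>1\<close> is an extreme point of the unit disc.\<close>

lemma S1_face:
  assumes eq: "complex_of_real t * \<psi> (u s) + complex_of_real (1 - t) * \<rho> (u s) = 1"
    and t: "0 < t" "t < 1"
    and \<psi>: "\<psi> \<in> states" and \<rho>: "\<rho> \<in> states" and s: "s \<in> carrier G"
  shows "\<psi> (u s) = 1"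
proof -
  have norm_u: "norm (u s) = 1"
    using cstar_identity[of "u s"] s power2_eq_1_iff[of "norm (u s)"] norm_ge_zero[of "u s"]
    by (auto simp del: norm_ge_zero)
  have 1: "cmod (\<psi> (u s)) \<le> 1" and 2: "cmod (\<rho> (u s)) \<le> 1"
    using state.contractive[of \<psi> "u s"] state.contractive[of \<rho> "u s"] \<psi> \<rho> norm_u
    by (simp_all add: states_iff_state)
  have "t * Re (\<psi> (u s)) + (1 - t) * Re (\<rho> (u s)) = 1"
    using arg_cong[OF eq, of Re] by simp
  moreover have "(1 - t) * Re (\<rho> (u s)) \<le> (1 - t) * 1"
    using 2 t complex_Re_le_cmod[of "\<rho> (u s)"] by (intro mult_left_mono) auto
  ultimately have "t * 1 \<le> t * Re (\<psi> (u s))" by simp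
  then have "1 \<le> Re (\<psi> (u s))" using t by simp
  moreover have "Re (\<psi> (u s)) \<le> 1"
    using 1 complex_Re_le_cmod[of "\<psi> (u s)"] by linarith
  ultimately have Re1: "Re (\<psi> (u s)) = 1" by simp
  \<comment> \<open>Modulus at most \<open>1\<close> together with real part \<open>1\<close> leaves
    no imaginary part.\<close>
  moreover have "(cmod (\<psi> (u s)))\<^sup>2 \<le> 1"
    using 1 by (simp add: power_le_one)
  ultimately have "Im (\<psi> (u s)) = 0"
    by (simp add: cmod_power2)
  with Re1 show ?thesis by (simp add: complex_eq_iff)
qed

text \<open>Extremality passes down to any subset containing the point. Conversely, by
  \<open>S1_face\<close> any decomposition into states of a point of \<open>S1 G u\<close> already
  takes place inside \<open>S1 G u\<close>.\<close>

lemma P1_eq: "P1 G u = extreme_points (S1 G u)"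
proof (intro equalityI subsetI)
  fix \<phi> assume "\<phi> \<in> P1 G u"
  then have "\<phi> \<in> extreme_points states" "\<phi> \<in> S1 G u"
    by (auto simp: P1_def pure_states_def S1_def extreme_points_def)
  moreover have "S1 G u \<subseteq> states" by (auto simp: S1_def)
  ultimately show "\<phi> \<in> extreme_points (S1 G u)"
    unfolding extreme_points_def by blast
next
  fix \<phi> assume ext: "\<phi> \<in> extreme_points (S1 G u)"
  then have \<phi>: "\<phi> \<in> S1 G u" by (simp add: extreme_points_def)
  then have "\<phi> \<in> states" by (simp add: S1_def)
  moreover have "\<psi> = \<phi> \<and> \<rho> = \<phi>"
    if \<psi>: "\<psi> \<in> states" and \<rho>: "\<rho> \<in> states" and t: "0 < t" "t < 1"
      and eq: "\<phi> = (\<lambda>x. complex_of_real t * \<psi> x + complex_of_real (1 - t) * \<rho> x)" for \<psi> \<rho> t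
  proof -
    have conv: "complex_of_real t * \<psi> (u s) + complex_of_real (1 - t) * \<rho> (u s) = 1"
      if "s \<in> carrier G" for s
      using S1_u[OF \<phi> that] fun_cong[OF eq, of "u s"] by simp
    have "\<psi> (u s) = 1" if "s \<in> carrier G" for s
      by (rule S1_face[OF conv[OF that] t \<psi> \<rho> that])
    moreover have "\<rho> (u s) = 1" if s: "s \<in> carrier G" for s
      by (rule S1_face[of "1 - t" \<rho> s \<psi>])
        (use conv[OF s] t \<psi> \<rho> s in \<open>simp_all add: add.commute\<close>)
    ultimately have "\<psi> \<in> S1 G u" "\<rho> \<in> S1 G u" using \<psi> \<rho> by (simp_all add: S1_def)
    with ext t eq show ?thesis unfolding extreme_points_def by blast
  qed
  ultimately show "\<phi> \<in> P1 G u"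
    using S1_u[OF \<phi>] unfolding P1_def pure_states_def extreme_points_def by blast
qed

lemma S1_convex:
  assumes \<psi>: "\<psi> \<in> S1 G u" and \<rho>: "\<rho> \<in> S1 G u" and t: "0 < t" "t < 1"
  shows "(\<lambda>x. complex_of_real t * \<psi> x + complex_of_real (1 - t) * \<rho> x) \<in> S1 G u"
proof -
  interpret \<psi>: state \<psi> by (rule S1_state[OF \<psi>])
  interpret \<rho>: state \<rho> by (rule S1_state[OF \<rho>])
  have "state (\<lambda>x. complex_of_real t * \<psi> x + complex_of_real (1 - t) * \<rho> x)"
  proof
    fix x
    show "complex_of_real t * \<psi> (star x * x) + complex_of_real (1 - t) * \<rho> (star x * x) \<in> \<real>\<^sub>\<ge>\<^sub>0"
      using t by (intro nonneg_Reals_add_I nonneg_Reals_mult_I \<psi>.nonneg \<rho>.nonneg)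
        (simp_all add: complex_nonneg_Reals_iff)
  qed (simp_all add: \<psi>.add \<rho>.add \<psi>.scaleC \<rho>.scaleC algebra_simps)
  then show ?thesis
    using \<psi> \<rho> by (simp add: S1_def states_iff_state)
qed

text \<open>An affine bijection between convex sets preserves extreme points.\<close>

lemma restriction_P1: "restriction \<iota> ` P1 G u = ergodic_states G \<alpha>"
proof -
  have comb: "restriction \<iota> (\<lambda>x. complex_of_real t * \<psi> x + complex_of_real (1 - t) * \<rho> x) =
    (\<lambda>x. complex_of_real t * restriction \<iota> \<psi> x + complex_of_real (1 - t) * restriction \<iota> \<rho> x)"
    for t \<psi> \<rho> by (simp add: restriction_def fun_eq_iff)
  \<comment> \<open>Injectivity is available only on \<open>S1 G u\<close>; \<open>S1_convex\<close>
    puts the convex combination there.\<close>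
  have iff: "restriction \<iota> \<phi> =
      (\<lambda>x. complex_of_real t * restriction \<iota> \<psi> x + complex_of_real (1 - t) * restriction \<iota> \<rho> x) \<longleftrightarrow>
      \<phi> = (\<lambda>x. complex_of_real t * \<psi> x + complex_of_real (1 - t) * \<rho> x)"
    if "\<phi> \<in> S1 G u" "\<psi> \<in> S1 G u" "\<rho> \<in> S1 G u" "0 < t" "t < 1" for \<phi> \<psi> \<rho> t
    unfolding comb[symmetric]
    by (rule inj_on_eq_iff[OF inj_restriction]) (use that S1_convex in auto)
  have eq: "restriction \<iota> \<phi> \<in> extreme_points (restriction \<iota> ` S1 G u) \<longleftrightarrow>
    \<phi> \<in> extreme_points (S1 G u)" if \<phi>: "\<phi> \<in> S1 G u" for \<phi>
  proof -
    have "restriction \<iota> \<phi> \<in> extreme_points (restriction \<iota> ` S1 G u) \<longleftrightarrow>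
      (\<forall>\<psi>\<in>S1 G u. \<forall>\<rho>\<in>S1 G u. \<forall>t::real. 0 < t \<and> t < 1 \<and> restriction \<iota> \<phi> =
        (\<lambda>x. complex_of_real t * restriction \<iota> \<psi> x + complex_of_real (1 - t) * restriction \<iota> \<rho> x)
        \<longrightarrow> restriction \<iota> \<psi> = restriction \<iota> \<phi> \<and> restriction \<iota> \<rho> = restriction \<iota> \<phi>)"
      using \<phi> by (simp add: extreme_points_def)
    also have "\<dots> \<longleftrightarrow> (\<forall>\<psi>\<in>S1 G u. \<forall>\<rho>\<in>S1 G u. \<forall>t::real. 0 < t \<and> t < 1 \<and>
        \<phi> = (\<lambda>x. complex_of_real t * \<psi> x + complex_of_real (1 - t) * \<rho> x)
        \<longrightarrow> \<psi> = \<phi> \<and> \<rho> = \<phi>)"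
      by (intro ball_cong refl all_cong1 imp_cong conj_cong iff[OF \<phi>]
          inj_on_eq_iff[OF inj_restriction] \<phi>)
    finally show ?thesis using \<phi> by (simp add: extreme_points_def)
  qed
  have sub: "extreme_points K \<subseteq> K" for K :: "('z \<Rightarrow> complex) set"
    by (auto simp: extreme_points_def)
  show ?thesis
    unfolding P1_eq ergodic_states_def restriction_image_S1[symmetric]
  proof (intro equalityI subsetI)
    fix x assume "x \<in> restriction \<iota> ` extreme_points (S1 G u)"
    then show "x \<in> extreme_points (restriction \<iota> ` S1 G u)"
      using eq sub by blast
  next
    fix x assume x: "x \<in> extreme_points (restriction \<iota> ` S1 G u)"
    then obtain \<phi> where "\<phi> \<in> S1 G u" "x = restriction \<iota> \<phi>" using sub by blast
    with x eq show "x \<in> restriction \<iota> ` extreme_points (S1 G u)" by blast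
  qed
qed

text \<open>Both sets carry the subspace topologies of the previous homeomorphism, which matches
  them by \<open>restriction_P1\<close>.\<close>

lemma homeomorphic_map_P1:
  "homeomorphic_map (weak_star (P1 G u)) (weak_star (ergodic_states G \<alpha>)) (restriction \<iota>)"
proof -
  have sub: "P1 G u \<subseteq> S1 G u" "ergodic_states G \<alpha> \<subseteq> invariant_states G \<alpha>"
    by (auto simp: P1_eq ergodic_states_def extreme_points_def)
  show ?thesis
    unfolding weak_star_subset[OF sub(1)] weak_star_subset[OF sub(2)]
    by (rule homeomorphic_map_subtopologies[OF homeomorphic_map_S1])
      (use sub restriction_P1 in \<open>simp add: inf.absorb2\<close>)
qed

end

theorem theorem3p2:
  fixes G :: "('g, 'm) monoid_scheme"
    and \<alpha> :: "'g \<Rightarrow> 'a::unital_cstar_algebra \<Rightarrow> 'a"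
    and \<iota> :: "'a \<Rightarrow> 'b::unital_cstar_algebra"
    and u :: "'g \<Rightarrow> 'b"
  assumes "group G"
    and "\<alpha> \<in> hom G cstar_Aut"
    and "full_crossed_product G \<alpha> \<iota> u"
  shows "homeomorphic_map (weak_star (S1 G u)) (weak_star (invariant_states G \<alpha>))
           (restriction \<iota>)
       \<and> homeomorphic_map (weak_star (P1 G u)) (weak_star (ergodic_states G \<alpha>))
           (restriction \<iota>)"
proof -
  interpret crossed_product G \<alpha> \<iota> u
    using assms by (simp add: crossed_product_def crossed_product_axioms_def
        cstar_dynamical_system_def cstar_dynamical_system_axioms_def)
  show ?thesis using homeomorphic_map_S1 homeomorphic_map_P1 by simp
qed

end
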